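(* Let $r\ge4$. Suppose that $(A,\iota)$ is an associative $\Lambda$-torus with involution and $(A',\iota')$ is an associative $\Lambda'$-torus with involution. Let $L(A,\iota)=\mathrm{ssp}_{2r}(A,\iota)$ and $L(A',\iota')=\mathrm{ssp}_{2r}(A',\iota')$. Then the following are equivalent: (a) $(A,\iota)$ is isograded-isomorphic to $(A',\iota')$. (b) $L(A,\iota)$ and $L(A',\iota')$ are bi-isomorphic. (c) $L(A,\iota)$ is isotopic to $L(A',\iota')$.
   Context: **Conventions.** $F$ is a field of characteristic $0$; all algebras are over $F$ and (except Lie algebras) unital. $\Lambda,\Lambda'$ are finitely generated free abelian groups. For a $\Lambda$-graded algebra $A=\bigoplus_\lambda A^\lambda$, $\mathrm{supp}_\Lambda(A)=\{\lambda:A^\lambda\ne0\}$. **Associative tori with involution.** An associative $\Lambda$-torus is a $\Lambda$-graded associative algebra $A$ such that for $\lambda\in\mathrm{supp}_\Lambda(A)$ the space $A^\lambda$ is spanned by a single invertible element, and $\Lambda$ is generated by $\mathrm{supp}_\Lambda(A)$ (then $\mathrm{supp}_\Lambda(A)=\Lambda$). An associative $\Lambda$-torus with involution is a pair $(A,\iota)$ with $A$ an associative $\Lambda$-torus and $\iota$ an antiautomorphism of $A$ with $\iota^2=\mathrm{id}$ and $\iota(A^\lambda)=A^\lambda$. $(A,\iota)$ and $(A',\iota')$ are isograded-isomorphic if there are an algebra isomorphism $\eta:A\to A'$ with $\eta\iota=\iota'\eta$ and a group isomorphism $\eta_{\mathrm{gr}}:\Lambda\to\Lambda'$ with $\eta(A^\lambda)=A'^{\,\eta_{\mathrm{gr}}(\lambda)}$.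 **$\mathrm{ssp}_{2r}(A,\iota)$.** Let $\Delta=\{0\}\cup\{\varepsilon_i-\varepsilon_j:1\le i\neq j\le r\}\cup\{\pm(\varepsilon_i+\varepsilon_j):1\le i\le j\le r\}$ be the root system of type $C_r$ ($\varepsilon_1,\dots,\varepsilon_r$ a basis of the space spanned by $\Delta$), $Q=\mathrm{span}_{\mathbb Z}\Delta$. Write $\bar x=\iota(x)$, $\bar X=(\bar x_{ij})$ for $X=(x_{ij})\in\mathrm{Mat}_r(A)$, $A_+=\{x:\bar x=x\}$, and $[A,A]$ for the span of commutators. $L(A,\iota)=\mathrm{ssp}_{2r}(A,\iota)$ is the set of matrices $\begin{bmatrix}X&Y\\Z&-\bar X^t\end{bmatrix}$ with $X,Y,Z\in\mathrm{Mat}_r(A)$, $\bar Y^t=Y$, $\bar Z^t=Z$, $\mathrm{tr}(X)\in A_++[A,A]$, a Lie algebra under commutator. With matrix units $e_{i,j}$ put $\ell_{ij}(x)=xe_{i,j}-\bar xe_{j+r,i+r}$ ($i\ne j$), $m_{ij}(x)=xe_{i,j+r}+\bar xe_{j,i+r}$, $n_{ij}(x)=xe_{i+r,j}+\bar xe_{j+r,i}$ ($1\le i,j\le r$). It is $Q\times\Lambda$-graded by $L_{\varepsilon_i-\varepsilon_j}^\lambda=\ell_{ij}(A^\lambda)$ ($i\neq j$), $L_{\varepsilon_i+\varepsilon_j}^\lambda=m_{ij}(A^\lambda)$, $L_{-(\varepsilon_i+\varepsilon_j)}^\lambda=n_{ij}(A^\lambda)$, $L_0^\lambda=\{\sum_{i=1}^r(x_ie_{i,i}-\bar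 x_ie_{i+r,i+r}):x_i\in A^\lambda,\ \sum x_i\in A_++[A,A]\}$, and $0$ for $\alpha\in Q\setminus\Delta$. It is a centreless Lie $\Lambda$-torus of type $\Delta$. **Bi-isomorphism and isotopy of Lie tori of type $\Delta$.** For Lie tori $L=\bigoplus_{Q\times\Lambda}L_\beta^\lambda$, $L'=\bigoplus_{Q\times\Lambda'}L'^{\lambda}_\beta$ of type $\Delta$, a bi-isomorphism is a Lie algebra isomorphism $\varphi:L\to L'$ for which there are group isomorphisms $\varphi_r:Q\to Q$, $\varphi_e:\Lambda\to\Lambda'$ with $\varphi(L_\beta^\lambda)=L'^{\,\varphi_e(\lambda)}_{\varphi_r(\beta)}$. For a group homomorphism $s:Q\to\Lambda$, $L^{(s)}$ is the Lie algebra $L$ with grading $(L^{(s)})_\beta^\lambda=L_\beta^{\lambda+s(\beta)}$; $s$ is admissible for $L$ if $L_\beta^{s(\beta)}\ne0$ for all $0\ne\beta\in\Delta$ (equivalently, $L^{(s)}$ is again a Lie torus), and then $L^{(s)}$ is an isotope of $L$. $L$ is isotopic to $L'$ if some isotope of $L$ is bi-isomorphic to $L'$. *)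

theory Defs
  imports "HOL-Analysis.Analysis"
begin

section \<open>Abelian groups as integer modules\<close>

definition zmul :: "int \<Rightarrow> 'l::ab_group_add \<Rightarrow> 'l" where
  "zmul n x = (if 0 \<le> n then ((+) x ^^ nat n) 0 else - (((+) x ^^ nat (- n)) 0))"

lemma zmul_0 [simp]: "zmul 0 x = 0"
  by (simp add: zmul_def)

lemma zmul_add_one: "zmul (n + 1) x = x + zmul n x"
proof (cases "0 \<le> n")
  case True
  then show ?thesis by (simp add: zmul_def nat_add_distrib)
next
  case False
  then have "nat (- n) = Suc (nat (- n - 1))" by simp
  moreover have "- (n + 1) = - n - 1" by simp
  ultimately show ?thesis
    using False by (cases "n = - 1") (simp_all add: zmul_def)
qed

lemma zmul_diff_one: "zmul (n - 1) x = zmul n x - x"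
  using zmul_add_one[of "n - 1" x] by simp

lemma zmul_1 [simp]: "zmul 1 x = x"
  using zmul_add_one[of 0 x] by simp

lemma zmul_add_left: "zmul (m + n) x = zmul m x + zmul n x"
proof (induction m rule: int_induct[of _ 0])
  case (step1 i)
  have "zmul (i + 1 + n) x = x + zmul (i + n) x"
    using zmul_add_one[of "i + n" x] by (simp add: algebra_simps)
  with step1 show ?case by (simp only: zmul_add_one) (simp add: algebra_simps)
next
  case (step2 i)
  have "zmul (i - 1 + n) x = zmul (i + n) x - x"
    using zmul_diff_one[of "i + n" x] by (simp add: algebra_simps)
  with step2 show ?case by (simp only: zmul_diff_one) (simp add: algebra_simps)
qed simp

lemma zmul_add_right: "zmul n (x + y) = zmul n x + zmul n y"
  by (induction n rule: int_induct[of _ 0]) (simp_all add: zmul_add_one zmul_diff_one)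

lemma zmul_zmul: "zmul m (zmul n x) = zmul (m * n) x"
proof (induction m rule: int_induct[of _ 0])
  case (step1 i)
  then show ?case by (simp add: zmul_add_one zmul_add_left algebra_simps)
next
  case (step2 i)
  have "zmul (i * n) x = zmul ((i - 1) * n) x + zmul n x"
    by (simp add: zmul_add_left[symmetric] algebra_simps)
  with step2 show ?case by (simp add: zmul_diff_one)
qed simp

lemma module_zmul: "module (zmul :: int \<Rightarrow> 'l::ab_group_add \<Rightarrow> 'l)"
  by unfold_locales (simp_all add: zmul_add_left zmul_add_right zmul_zmul)

text \<open>\<open>zspan S\<close> is the subgroup generated by \<open>S\<close>.\<close>

abbreviation zspan :: "'l::ab_group_add set \<Rightarrow> 'l set" where
  "zspan \<equiv> module.span zmul"

definition fg_free_abelian :: "'l::ab_group_add itself \<Rightarrow> bool" where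
  "fg_free_abelian _ \<longleftrightarrow>
     (\<exists>B :: 'l set. finite B \<and> \<not> module.dependent zmul B \<and> zspan B = UNIV)"

definition group_hom_on :: "'g::ab_group_add set \<Rightarrow> ('g \<Rightarrow> 'h::ab_group_add) \<Rightarrow> bool" where
  "group_hom_on G f \<longleftrightarrow> (\<forall>x\<in>G. \<forall>y\<in>G. f (x + y) = f x + f y)"

definition group_iso_on ::
  "'g::ab_group_add set \<Rightarrow> 'h::ab_group_add set \<Rightarrow> ('g \<Rightarrow> 'h) \<Rightarrow> bool" where
  "group_iso_on G H f \<longleftrightarrow> bij_betw f G H \<and> group_hom_on G f"


section \<open>Associative tori with involution\<close>

text \<open>Sort \<open>ring_1\<close> includes \<open>1 \<noteq> 0\<close>.\<close>

locale assoc_algebra = vector_space smul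
  for smul :: "'f::field \<Rightarrow> 'a::ring_1 \<Rightarrow> 'a" +
  assumes smul_mult_left: "smul c (x * y) = smul c x * y"
    and smul_mult_right: "smul c (x * y) = x * smul c y"

locale graded_assoc_algebra = assoc_algebra smul
  for smul :: "'f::field \<Rightarrow> 'a::ring_1 \<Rightarrow> 'a" +
  fixes gr :: "'l::ab_group_add \<Rightarrow> 'a set"
  assumes subspace_gr: "subspace (gr \<alpha>)"
    and direct_sum_gr:
      "\<exists>!c. (\<forall>\<alpha>. c \<alpha> \<in> gr \<alpha>) \<and> finite {\<alpha>. c \<alpha> \<noteq> 0} \<and> x = (\<Sum>\<alpha> | c \<alpha> \<noteq> 0. c \<alpha>)"
    and mult_gr: "x \<in> gr \<alpha> \<Longrightarrow> y \<in> gr \<mu> \<Longrightarrow> x * y \<in> gr (\<alpha> + \<mu>)"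

definition gr_supp :: "('l \<Rightarrow> 'a::zero set) \<Rightarrow> 'l set" where
  "gr_supp gr = {\<alpha>. gr \<alpha> \<noteq> {0}}"

locale assoc_torus = graded_assoc_algebra smul gr
  for smul :: "'f::field \<Rightarrow> 'a::ring_1 \<Rightarrow> 'a"
    and gr :: "'l::ab_group_add \<Rightarrow> 'a set" +
  assumes gr_spanned_by_unit:
      "\<alpha> \<in> gr_supp gr \<Longrightarrow> \<exists>x y. x * y = 1 \<and> y * x = 1 \<and> gr \<alpha> = span {x}"
    and supp_generates: "zspan (gr_supp gr) = UNIV"

locale assoc_torus_inv = assoc_torus smul gr
  for smul :: "'f::field \<Rightarrow> 'a::ring_1 \<Rightarrow> 'a"
    and gr :: "'l::ab_group_add \<Rightarrow> 'a set" +
  fixes \<iota> :: "'a \<Rightarrow> 'a"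
  assumes inv_linear: "Vector_Spaces.linear smul smul \<iota>"
    and inv_mult: "\<iota> (x * y) = \<iota> y * \<iota> x"
    and inv_inv: "\<iota> (\<iota> x) = x"
    and inv_gr: "\<iota> ` gr \<alpha> = gr \<alpha>"

definition isograded_isomorphic ::
  "('f::field \<Rightarrow> 'a::ring_1 \<Rightarrow> 'a) \<Rightarrow> ('l::ab_group_add \<Rightarrow> 'a set) \<Rightarrow> ('a \<Rightarrow> 'a) \<Rightarrow>
   ('f \<Rightarrow> 'b::ring_1 \<Rightarrow> 'b) \<Rightarrow> ('k::ab_group_add \<Rightarrow> 'b set) \<Rightarrow> ('b \<Rightarrow> 'b) \<Rightarrow> bool" where
  "isograded_isomorphic smul gr \<iota> smul' gr' \<iota>' \<longleftrightarrow>
     (\<exists>\<eta> \<eta>gr. bij \<eta> \<and> Vector_Spaces.linear smul smul' \<eta> \<and>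
        (\<forall>x y. \<eta> (x * y) = \<eta> x * \<eta> y) \<and> \<eta> 1 = 1 \<and>
        (\<forall>x. \<eta> (\<iota> x) = \<iota>' (\<eta> x)) \<and>
        group_iso_on UNIV UNIV \<eta>gr \<and>
        (\<forall>\<alpha>. \<eta> ` gr \<alpha> = gr' (\<eta>gr \<alpha>)))"


section \<open>The root system of type C\<close>

text \<open>The basis of the root space is indexed by the finite type \<open>'r\<close>, so the rank is
  \<open>CARD('r)\<close>. All roots are integral in this basis.\<close>

definition eps :: "'r::finite \<Rightarrow> int^'r" where
  "eps i = axis i 1"

definition roots :: "(int^'r::finite) set" where
  "roots = {0} \<union> {eps i - eps j | i j. i \<noteq> j}
           \<union> {eps i + eps j | i j. True} \<union> {- (eps i + eps j) | i j. True}"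

definition root_lattice :: "(int^'r::finite) set" where
  "root_lattice = zspan roots"


section \<open>Graded Lie algebras: bi-isomorphism and isotopy\<close>

text \<open>The homogeneous components are indexed by all of \<open>int^'r\<close>, but only
  those with first index in \<open>root_lattice\<close> are ever considered.\<close>

record ('f, 'm, 'r, 'l) graded_lie =
  lie_carrier :: "'m set"
  lie_scale :: "'f \<Rightarrow> 'm \<Rightarrow> 'm"
  lie_bracket :: "'m \<Rightarrow> 'm \<Rightarrow> 'm"
  lie_comp :: "int^'r \<Rightarrow> 'l \<Rightarrow> 'm set"

definition lie_iso ::
  "('f, 'm::ab_group_add, 'r::finite, 'l) graded_lie \<Rightarrow>
   ('f, 'n::ab_group_add, 'r, 'k) graded_lie \<Rightarrow> ('m \<Rightarrow> 'n) \<Rightarrow> bool" where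
  "lie_iso L L' \<phi> \<longleftrightarrow>
     bij_betw \<phi> (lie_carrier L) (lie_carrier L') \<and>
     (\<forall>x\<in>lie_carrier L. \<forall>y\<in>lie_carrier L. \<phi> (x + y) = \<phi> x + \<phi> y) \<and>
     (\<forall>c. \<forall>x\<in>lie_carrier L. \<phi> (lie_scale L c x) = lie_scale L' c (\<phi> x)) \<and>
     (\<forall>x\<in>lie_carrier L. \<forall>y\<in>lie_carrier L.
        \<phi> (lie_bracket L x y) = lie_bracket L' (\<phi> x) (\<phi> y))"

definition bi_isomorphic ::
  "('f, 'm::ab_group_add, 'r::finite, 'l::ab_group_add) graded_lie \<Rightarrow>
   ('f, 'n::ab_group_add, 'r, 'k::ab_group_add) graded_lie \<Rightarrow> bool" where
  "bi_isomorphic L L' \<longleftrightarrow>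
     (\<exists>\<phi> \<phi>r \<phi>e. lie_iso L L' \<phi> \<and>
        group_iso_on root_lattice root_lattice \<phi>r \<and>
        group_iso_on UNIV UNIV \<phi>e \<and>
        (\<forall>\<beta>\<in>root_lattice. \<forall>\<alpha>. \<phi> ` lie_comp L \<beta> \<alpha> = lie_comp L' (\<phi>r \<beta>) (\<phi>e \<alpha>)))"

definition isotope ::
  "('f, 'm, 'r::finite, 'l::ab_group_add) graded_lie \<Rightarrow> (int^'r \<Rightarrow> 'l) \<Rightarrow>
   ('f, 'm, 'r, 'l) graded_lie" where
  "isotope L s = L\<lparr>lie_comp := \<lambda>\<beta> \<alpha>. lie_comp L \<beta> (\<alpha> + s \<beta>)\<rparr>"

definition admissible ::
  "('f, 'm::ab_group_add, 'r::finite, 'l::ab_group_add) graded_lie \<Rightarrow> (int^'r \<Rightarrow> 'l) \<Rightarrow> bool" where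
  "admissible L s \<longleftrightarrow> (\<forall>\<beta>\<in>roots. \<beta> \<noteq> 0 \<longrightarrow> lie_comp L \<beta> (s \<beta>) \<noteq> {0})"

definition isotopic ::
  "('f, 'm::ab_group_add, 'r::finite, 'l::ab_group_add) graded_lie \<Rightarrow>
   ('f, 'n::ab_group_add, 'r, 'k::ab_group_add) graded_lie \<Rightarrow> bool" where
  "isotopic L L' \<longleftrightarrow>
     (\<exists>s. group_hom_on root_lattice s \<and> admissible L s \<and> bi_isomorphic (isotope L s) L')"


section \<open>The special symplectic Lie algebra\<close>

text \<open>Rows and columns of \<open>2r \<times> 2r\<close> matrices are indexed by \<open>'r + 'r\<close>:
  \<open>Inl i\<close> stands for \<open>i\<close> and \<open>Inr i\<close> for \<open>i + r\<close>.\<close>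

type_synonym ('a, 'r) dmat = "'a^('r + 'r)^('r + 'r)"

definition block_matrix ::
  "'a^'r^'r \<Rightarrow> 'a^'r^'r \<Rightarrow> 'a^'r^'r \<Rightarrow> 'a^'r^'r \<Rightarrow> ('a, 'r::finite) dmat" where
  "block_matrix X Y Z W = (\<chi> p q. case p of
       Inl i \<Rightarrow> (case q of Inl j \<Rightarrow> X $ i $ j | Inr j \<Rightarrow> Y $ i $ j)
     | Inr i \<Rightarrow> (case q of Inl j \<Rightarrow> Z $ i $ j | Inr j \<Rightarrow> W $ i $ j))"

text \<open>\<open>munit p q x\<close> is \<open>x\<close> times the matrix unit in row \<open>p\<close>, column \<open>q\<close>.\<close>

definition munit :: "'n::finite \<Rightarrow> 'n \<Rightarrow> 'a::zero \<Rightarrow> 'a^'n^'n" where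
  "munit p q x = axis p (axis q x)"

definition conj_transpose :: "('a \<Rightarrow> 'a) \<Rightarrow> 'a^'n::finite^'n \<Rightarrow> 'a^'n^'n" where
  "conj_transpose \<iota> X = transpose (map_matrix \<iota> X)"

text \<open>The subspace \<open>A\<^sub>+ + [A,A]\<close>.\<close>

definition sym_plus_comm ::
  "('f::field \<Rightarrow> 'a::ring_1 \<Rightarrow> 'a) \<Rightarrow> ('a \<Rightarrow> 'a) \<Rightarrow> 'a set" where
  "sym_plus_comm smul \<iota> =
     {a + b | a b. \<iota> a = a \<and> b \<in> module.span smul {x * y - y * x | x y. True}}"

definition ssp_carrier ::
  "('f::field \<Rightarrow> 'a::ring_1 \<Rightarrow> 'a) \<Rightarrow> ('a \<Rightarrow> 'a) \<Rightarrow> ('a, 'r::finite) dmat set" where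
  "ssp_carrier smul \<iota> =
     {block_matrix X Y Z (- conj_transpose \<iota> X) | X Y Z.
        conj_transpose \<iota> Y = Y \<and> conj_transpose \<iota> Z = Z \<and>
        trace X \<in> sym_plus_comm smul \<iota>}"

definition ssp_l :: "('a::ring_1 \<Rightarrow> 'a) \<Rightarrow> 'r::finite \<Rightarrow> 'r \<Rightarrow> 'a \<Rightarrow> ('a, 'r) dmat" where
  "ssp_l \<iota> i j x = munit (Inl i) (Inl j) x - munit (Inr j) (Inr i) (\<iota> x)"

definition ssp_m :: "('a::ring_1 \<Rightarrow> 'a) \<Rightarrow> 'r::finite \<Rightarrow> 'r \<Rightarrow> 'a \<Rightarrow> ('a, 'r) dmat" where
  "ssp_m \<iota> i j x = munit (Inl i) (Inr j) x + munit (Inl j) (Inr i) (\<iota> x)"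

definition ssp_n :: "('a::ring_1 \<Rightarrow> 'a) \<Rightarrow> 'r::finite \<Rightarrow> 'r \<Rightarrow> 'a \<Rightarrow> ('a, 'r) dmat" where
  "ssp_n \<iota> i j x = munit (Inr i) (Inl j) x + munit (Inr j) (Inl i) (\<iota> x)"

definition ssp_zero_comp ::
  "('f::field \<Rightarrow> 'a::ring_1 \<Rightarrow> 'a) \<Rightarrow> ('l \<Rightarrow> 'a set) \<Rightarrow> ('a \<Rightarrow> 'a) \<Rightarrow> 'l \<Rightarrow>
   ('a, 'r::finite) dmat set" where
  "ssp_zero_comp smul gr \<iota> \<alpha> =
     {\<Sum>i\<in>UNIV. munit (Inl i) (Inl i) (x i) - munit (Inr i) (Inr i) (\<iota> (x i)) | x.
        (\<forall>i. x i \<in> gr \<alpha>) \<and> (\<Sum>i\<in>UNIV. x i) \<in> sym_plus_comm smul \<iota>}"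

text \<open>For a nonzero root at most one of the three families of images below is nonempty.
  The root \<open>\<epsilon>\<^sub>i + \<epsilon>\<^sub>j\<close> arises from \<open>(i, j)\<close> and from \<open>(j, i)\<close>, which give the same
  image because \<open>ssp_m \<iota> j i x = ssp_m \<iota> i j (\<iota> x)\<close> and \<open>\<iota>\<close> preserves
  \<open>gr \<alpha>\<close>; likewise for \<open>ssp_n\<close>. The union with \<open>{0}\<close> thus matters only off the
  roots.\<close>

definition ssp_comp ::
  "('f::field \<Rightarrow> 'a::ring_1 \<Rightarrow> 'a) \<Rightarrow> ('l \<Rightarrow> 'a set) \<Rightarrow> ('a \<Rightarrow> 'a) \<Rightarrow>
   int^'r \<Rightarrow> 'l \<Rightarrow> ('a, 'r::finite) dmat set" where
  "ssp_comp smul gr \<iota> \<beta> \<alpha> =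
     (if \<beta> = 0 then ssp_zero_comp smul gr \<iota> \<alpha>
      else {0}
        \<union> \<Union>{ssp_l \<iota> i j ` gr \<alpha> | i j. i \<noteq> j \<and> \<beta> = eps i - eps j}
        \<union> \<Union>{ssp_m \<iota> i j ` gr \<alpha> | i j. \<beta> = eps i + eps j}
        \<union> \<Union>{ssp_n \<iota> i j ` gr \<alpha> | i j. \<beta> = - (eps i + eps j)})"

definition ssp ::
  "'r::finite itself \<Rightarrow> ('f::field \<Rightarrow> 'a::ring_1 \<Rightarrow> 'a) \<Rightarrow> ('l \<Rightarrow> 'a set) \<Rightarrow> ('a \<Rightarrow> 'a) \<Rightarrow>
   ('f, ('a, 'r) dmat, 'r, 'l) graded_lie" where
  "ssp _ smul gr \<iota> =
     \<lparr>lie_carrier = ssp_carrier smul \<iota>,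
      lie_scale = (\<lambda>c. map_matrix (smul c)),
      lie_bracket = (\<lambda>M N. M ** N - N ** M),
      lie_comp = ssp_comp smul gr \<iota>\<rparr>"

end

theory Submission
  imports Defs
begin

text \<open>
  An isotopy from \<open>L(A,\<iota>)\<close> to \<open>L(A',\<iota>')\<close> acts on the root lattice by an automorphism that
  preserves the roots, and such an automorphism is a signed permutation of the weights
  \<open>\<plusminus>\<epsilon>\<^sub>i\<close>. Comparing short root spaces therefore gives linear maps \<open>f\<^sub>p\<^sub>q : A \<rightarrow> A'\<close> with
  \<open>f\<^sub>p\<^sub>t(xy) = f\<^sub>p\<^sub>q(x) f\<^sub>q\<^sub>t(y)\<close>, from which one extracts a graded algebra isomorphism
  \<open>\<eta>\<close> that carries \<open>\<iota>\<close> to \<open>y \<mapsto> h \<iota>'(y) h\<^sup>-\<^sup>1\<close> for some hermitian homogeneous unit \<open>h\<close>.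

  This twist can be undone. Homogeneous elements commute or anticommute with each other, and
  modulo squares, which are central, \<open>h\<close> is a hermitian \<open>w\<close> of degree \<open>\<delta>\<close>. Choose a homomorphism
  \<open>b : \<Lambda> \<rightarrow> \<int>\<close> whose parity records anticommutation with \<open>h\<close> and with \<open>b(\<delta>) = 0\<close>. Then
  \<open>x \<mapsto> \<plusminus> x w\<^bsup>b(\<alpha>)\<^esup>\<close> for \<open>x \<in> A'\<^sup>\<alpha>\<close>, with suitable signs, is an isograded automorphism that
  carries the twisted involution to \<open>\<iota>'\<close>.
\<close>

section \<open>Homogeneous elements of associative tori\<close>

context graded_assoc_algebra
begin

definition hcomp :: "'a \<Rightarrow> 'l \<Rightarrow> 'a" where
  "hcomp x = (THE c. (\<forall>\<alpha>. c \<alpha> \<in> gr \<alpha>) \<and> finite {\<alpha>. c \<alpha> \<noteq> 0} \<and> x = (\<Sum>\<alpha> | c \<alpha> \<noteq> 0. c \<alpha>))"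

lemma hcomp_props:
  shows hcomp_gr: "hcomp x \<alpha> \<in> gr \<alpha>"
    and finite_hcomp: "finite {\<alpha>. hcomp x \<alpha> \<noteq> 0}"
    and sum_hcomp: "(\<Sum>\<alpha> | hcomp x \<alpha> \<noteq> 0. hcomp x \<alpha>) = x"
  using theI'[OF direct_sum_gr[of x]] unfolding hcomp_def[symmetric] by auto

text \<open>The sum may run over any finite set outside which \<open>c\<close> vanishes, so that
  decompositions with different supports can be compared over a common index set.\<close>

lemma hcomp_unique:
  assumes "finite S" "\<And>\<alpha>. c \<alpha> \<in> gr \<alpha>" "\<And>\<alpha>. \<alpha> \<notin> S \<Longrightarrow> c \<alpha> = 0" "x = (\<Sum>\<alpha>\<in>S. c \<alpha>)"
  shows "hcomp x = c"
proof -
  have sub: "{\<alpha>. c \<alpha> \<noteq> 0} \<subseteq> S" using assms(3) by auto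
  have "x = (\<Sum>\<alpha> | c \<alpha> \<noteq> 0. c \<alpha>)"
    unfolding assms(4) by (rule sum.mono_neutral_right) (use assms(1) sub in auto)
  moreover have "finite {\<alpha>. c \<alpha> \<noteq> 0}" using sub assms(1) finite_subset by blast
  ultimately show ?thesis
    unfolding hcomp_def by (intro the1_equality[OF direct_sum_gr]) (use assms(2) in auto)
qed

lemma zero_gr [simp]: "0 \<in> gr \<alpha>"
  using subspace_0[OF subspace_gr] .

lemma add_gr: "x \<in> gr \<alpha> \<Longrightarrow> y \<in> gr \<alpha> \<Longrightarrow> x + y \<in> gr \<alpha>"
  using subspace_add[OF subspace_gr] .

lemma smul_gr: "x \<in> gr \<alpha> \<Longrightarrow> smul c x \<in> gr \<alpha>"
  using subspace_scale[OF subspace_gr] .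

lemma minus_gr: "x \<in> gr \<alpha> \<Longrightarrow> - x \<in> gr \<alpha>"
  using subspace_neg[OF subspace_gr] .

lemma diff_gr: "x \<in> gr \<alpha> \<Longrightarrow> y \<in> gr \<alpha> \<Longrightarrow> x - y \<in> gr \<alpha>"
  using subspace_diff[OF subspace_gr] .

lemma hcomp_superset: "finite S \<Longrightarrow> {\<alpha>. hcomp x \<alpha> \<noteq> 0} \<subseteq> S \<Longrightarrow> (\<Sum>\<alpha>\<in>S. hcomp x \<alpha>) = x"
  by (subst (2) sum_hcomp[of x, symmetric], rule sum.mono_neutral_right) auto

lemma hcomp_add: "hcomp (x + y) \<alpha> = hcomp x \<alpha> + hcomp y \<alpha>"
proof -
  let ?S = "{\<alpha>. hcomp x \<alpha> \<noteq> 0} \<union> {\<alpha>. hcomp y \<alpha> \<noteq> 0}"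
  have "hcomp (x + y) = (\<lambda>\<alpha>. hcomp x \<alpha> + hcomp y \<alpha>)"
    by (rule hcomp_unique[where S = ?S])
       (auto simp: finite_hcomp hcomp_gr sum.distrib hcomp_superset intro: add_gr)
  then show ?thesis by simp
qed

lemma hcomp_smul: "hcomp (smul c x) \<alpha> = smul c (hcomp x \<alpha>)"
proof -
  have "hcomp (smul c x) = (\<lambda>\<alpha>. smul c (hcomp x \<alpha>))"
    by (rule hcomp_unique[where S = "{\<alpha>. hcomp x \<alpha> \<noteq> 0}"])
       (auto simp: finite_hcomp hcomp_gr sum_hcomp scale_sum_right[symmetric] intro: smul_gr)
  then show ?thesis by simp
qed

lemma hcomp_homogeneous: "x \<in> gr \<alpha> \<Longrightarrow> hcomp x = (\<lambda>\<beta>. if \<beta> = \<alpha> then x else 0)"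
  by (rule hcomp_unique[where S = "{\<alpha>}"]) auto

text \<open>Transported along the injective \<open>d\<close>, the family \<open>c\<close> is a
  homogeneous decomposition of 0, which is unique. The reindexing covers sums whose degrees were
  moved, by a translation in \<open>cancel_gr\<close> and by a lattice automorphism in
  \<open>hermitian_twist\<close>.\<close>

lemma gr_independent:
  assumes "finite S" "inj_on d S" "\<And>a. a \<in> S \<Longrightarrow> c a \<in> gr (d a)" "(\<Sum>a\<in>S. c a) = 0" "a \<in> S"
  shows "c a = 0"
proof -
  define e where "e = (\<lambda>\<beta>. if \<beta> \<in> d ` S then c (the_inv_into S d \<beta>) else 0)"
  have e: "e (d b) = c b" if "b \<in> S" for b
    using that assms(2) by (simp add: e_def the_inv_into_f_f)
  have "(\<Sum>\<beta>\<in>d ` S. e \<beta>) = 0"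
    using assms(2,4) e by (simp add: sum.reindex)
  moreover have "e \<beta> \<in> gr \<beta>" for \<beta>
  proof (cases "\<beta> \<in> d ` S")
    case True
    then show ?thesis using assms(3) e by auto
  qed (simp add: e_def)
  ultimately have "hcomp 0 = e"
    using assms(1) by (intro hcomp_unique[where S = "d ` S"]) (auto simp: e_def)
  moreover have "hcomp 0 = (\<lambda>_. 0)" using hcomp_homogeneous[of 0 0] by auto
  ultimately show ?thesis using e[OF assms(5)] by metis
qed

lemma homogeneous_induct:
  assumes "\<And>\<alpha> x. x \<in> gr \<alpha> \<Longrightarrow> P x" "\<And>x y. P x \<Longrightarrow> P y \<Longrightarrow> P (x + y)"
  shows "P x"
proof -
  have "P (\<Sum>\<alpha>\<in>S. hcomp x \<alpha>)" if "finite S" for S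
    using that
  proof (induction S)
    case empty
    show ?case using assms(1)[of 0 0] by simp
  next
    case (insert \<alpha> S)
    then show ?case using assms(1)[OF hcomp_gr] assms(2) by simp
  qed
  then show ?thesis using finite_hcomp[of x] sum_hcomp[of x] by metis
qed

text \<open>Left multiplication by \<open>x\<close> shifts every component of \<open>z\<close> by
  \<open>\<alpha>\<close>, so only the component of degree \<open>\<gamma> - \<alpha>\<close> can
  contribute to \<open>x * z\<close>; the left inverse of \<open>x\<close> then cancels. This
  determines the degrees of 1 and of inverses.\<close>

lemma cancel_gr:
  assumes "x \<in> gr \<alpha>" "y * x = 1" "x * z \<in> gr \<gamma>"
  shows "z \<in> gr (\<gamma> - \<alpha>)"
proof -
  let ?S = "insert (\<gamma> - \<alpha>) {\<beta>. hcomp z \<beta> \<noteq> 0}"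
  let ?c = "\<lambda>\<beta>. x * hcomp z \<beta> - (if \<beta> = \<gamma> - \<alpha> then x * z else 0)"
  have fin: "finite ?S" by (simp add: finite_hcomp)
  have "?c (\<gamma> - \<alpha>) = 0"
  proof (rule gr_independent[where c = ?c and d = "\<lambda>\<beta>. \<alpha> + \<beta>", OF fin])
    show "?c \<beta> \<in> gr (\<alpha> + \<beta>)" if "\<beta> \<in> ?S" for \<beta>
      using mult_gr[OF assms(1) hcomp_gr[of z \<beta>]] assms(3) by (auto intro: diff_gr)
    have "(\<Sum>\<beta>\<in>?S. x * hcomp z \<beta>) = x * (\<Sum>\<beta>\<in>?S. hcomp z \<beta>)"
      by (rule sum_distrib_left[symmetric])
    also have "\<dots> = x * z"
      by (subst hcomp_superset[OF fin]) auto
    finally have 1: "(\<Sum>\<beta>\<in>?S. x * hcomp z \<beta>) = x * z" .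
    have 2: "(\<Sum>\<beta>\<in>?S. if \<beta> = \<gamma> - \<alpha> then x * z else 0) = x * z"
      by (subst sum.delta[OF fin]) simp
    show "(\<Sum>\<beta>\<in>?S. ?c \<beta>) = 0"
      unfolding sum_subtractf 1 2 by simp
  qed auto
  then have "y * (x * hcomp z (\<gamma> - \<alpha>)) = y * (x * z)" by simp
  then have "hcomp z (\<gamma> - \<alpha>) = z"
    by (simp add: mult.assoc[symmetric] assms(2))
  then show ?thesis using hcomp_gr by metis
qed

text \<open>Glues maps prescribed degree by degree into one map on the algebra. It builds the
  automorphism of \<open>hermitian_twist\<close>, whose formula depends on the degree.\<close>

definition hextend :: "('l \<Rightarrow> 'a \<Rightarrow> 'b::ab_group_add) \<Rightarrow> 'a \<Rightarrow> 'b" where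
  "hextend g x = (\<Sum>\<alpha> | hcomp x \<alpha> \<noteq> 0. g \<alpha> (hcomp x \<alpha>))"

lemma hextend_superset:
  assumes "\<And>\<alpha>. g \<alpha> 0 = 0" "finite S" "{\<alpha>. hcomp x \<alpha> \<noteq> 0} \<subseteq> S"
  shows "hextend g x = (\<Sum>\<alpha>\<in>S. g \<alpha> (hcomp x \<alpha>))"
  unfolding hextend_def by (rule sum.mono_neutral_left) (use assms in auto)

lemma hextend_homogeneous:
  assumes "\<And>\<alpha>. g \<alpha> 0 = 0" "x \<in> gr \<alpha>"
  shows "hextend g x = g \<alpha> x"
proof -
  have "hextend g x = (\<Sum>\<beta>\<in>{\<alpha>}. g \<beta> (hcomp x \<beta>))"
    by (rule hextend_superset) (auto simp: assms(1) hcomp_homogeneous[OF assms(2)])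
  then show ?thesis by (simp add: hcomp_homogeneous[OF assms(2)])
qed

lemma hextend_add:
  assumes "\<And>\<alpha> x y. g \<alpha> (x + y) = g \<alpha> x + g \<alpha> y"
  shows "hextend g (x + y) = hextend g x + hextend g y"
proof -
  let ?S = "{\<alpha>. hcomp x \<alpha> \<noteq> 0} \<union> {\<alpha>. hcomp y \<alpha> \<noteq> 0}"
  have 0: "g \<alpha> 0 = 0" for \<alpha> using assms[of \<alpha> 0 0] by simp
  have fin: "finite ?S" by (simp add: finite_hcomp)
  have "hextend g (x + y) = (\<Sum>\<alpha>\<in>?S. g \<alpha> (hcomp x \<alpha>) + g \<alpha> (hcomp y \<alpha>))"
    by (subst hextend_superset[of g, OF 0 fin]) (auto simp: hcomp_add assms)
  then show ?thesis
    using hextend_superset[of g, OF 0 fin, of x] hextend_superset[of g, OF 0 fin, of y]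
    by (simp add: sum.distrib)
qed

lemma hextend_smul:
  assumes "\<And>\<alpha> x. g \<alpha> (smul c x) = smul' c (g \<alpha> x)" "\<And>\<alpha>. g \<alpha> 0 = 0" "module smul'"
  shows "hextend g (smul c x) = smul' c (hextend g x)"
proof -
  have "hextend g (smul c x) = (\<Sum>\<alpha> | hcomp x \<alpha> \<noteq> 0. smul' c (g \<alpha> (hcomp x \<alpha>)))"
    by (subst hextend_superset[of g, OF assms(2) finite_hcomp[of x]]) (auto simp: hcomp_smul assms(1))
  then show ?thesis
    by (simp add: hextend_def module.scale_sum_right[OF assms(3)])
qed

end

section \<open>Homogeneous units and the support of a torus\<close>

context assoc_torus
begin

definition unit_inv :: "'a \<Rightarrow> 'a" where
  "unit_inv x = (SOME y. x * y = 1 \<and> y * x = 1)"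

lemma ex_homogeneous_nonzero: "\<exists>\<alpha> x. x \<in> gr \<alpha> \<and> x \<noteq> 0"
proof (rule ccontr)
  assume "\<not> ?thesis"
  then have "hcomp 1 \<alpha> = 0" for \<alpha> using hcomp_gr[of 1 \<alpha>] by blast
  then show False using sum_hcomp[of 1] by simp
qed

lemma homogeneous_cases:
  assumes "x \<in> gr \<alpha>" "x \<noteq> 0"
  obtains z k where "x = smul k z" "k \<noteq> 0" "gr \<alpha> = span {z}" "\<exists>y. z * y = 1 \<and> y * z = 1"
proof -
  have "\<alpha> \<in> gr_supp gr" using assms by (auto simp: gr_supp_def)
  from gr_spanned_by_unit[OF this] obtain z y where z: "z * y = 1" "y * z = 1" "gr \<alpha> = span {z}"
    by blast
  then obtain k where "x = smul k z" using assms(1) by (auto simp: span_singleton)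
  moreover have "k \<noteq> 0" using assms(2) calculation by auto
  ultimately show ?thesis using that z by blast
qed

lemma
  assumes "x \<in> gr \<alpha>" "x \<noteq> 0"
  shows unit_inv_right: "x * unit_inv x = 1"
    and unit_inv_left: "unit_inv x * x = 1"
proof -
  obtain z k y where z: "x = smul k z" "k \<noteq> 0" "z * y = 1" "y * z = 1"
    using homogeneous_cases[OF assms] by metis
  have "x * smul (inverse k) y = 1" "smul (inverse k) y * x = 1"
    using z by (simp_all add: smul_mult_left[symmetric] smul_mult_right[symmetric])
  then have "x * unit_inv x = 1 \<and> unit_inv x * x = 1"
    unfolding unit_inv_def by (intro someI[of "\<lambda>y. x * y = 1 \<and> y * x = 1" "smul (inverse k) y"] conjI)
  then show "x * unit_inv x = 1" "unit_inv x * x = 1" by blast+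
qed

text \<open>For a nonzero homogeneous \<open>x\<close> of degree \<open>\<alpha>\<close>, the
  product \<open>x * 1\<close> again has degree \<open>\<alpha>\<close>, and
  \<open>cancel_gr\<close> removes \<open>x\<close>.\<close>

lemma one_gr: "1 \<in> gr 0"
proof -
  obtain \<alpha> x where x: "x \<in> gr \<alpha>" "x \<noteq> 0" using ex_homogeneous_nonzero by blast
  then show ?thesis using cancel_gr[OF x(1) unit_inv_left[OF x], of 1 \<alpha>] by simp
qed

lemma unit_inv_gr: "x \<in> gr \<alpha> \<Longrightarrow> x \<noteq> 0 \<Longrightarrow> unit_inv x \<in> gr (- \<alpha>)"
  using cancel_gr[of x \<alpha> "unit_inv x" "unit_inv x" 0] unit_inv_left[of x \<alpha>] unit_inv_right[of x \<alpha>]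
    one_gr by simp

lemma unit_inv_nonzero: "x \<in> gr \<alpha> \<Longrightarrow> x \<noteq> 0 \<Longrightarrow> unit_inv x \<noteq> 0"
  using unit_inv_right[of x \<alpha>] by force

lemma mult_nonzero:
  assumes "x \<in> gr \<alpha>" "x \<noteq> 0" "y \<noteq> 0"
  shows "x * y \<noteq> 0" "y * x \<noteq> 0"
proof -
  show "x * y \<noteq> 0"
  proof
    assume "x * y = 0"
    then have "unit_inv x * x * y = 0" by (simp add: mult.assoc)
    then show False using unit_inv_left[OF assms(1,2)] assms(3) by simp
  qed
  show "y * x \<noteq> 0"
  proof
    assume "y * x = 0"
    then have "y * (x * unit_inv x) = 0" by (simp add: mult.assoc[symmetric])
    then show False using unit_inv_right[OF assms(1,2)] assms(3) by simp
  qed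
qed

lemma gr_proportional:
  assumes "x \<in> gr \<alpha>" "x \<noteq> 0" "y \<in> gr \<alpha>"
  obtains k where "y = smul k x"
proof -
  obtain z k where z: "x = smul k z" "k \<noteq> 0" "gr \<alpha> = span {z}"
    using homogeneous_cases[OF assms(1,2)] by metis
  then obtain m where "y = smul m z" using assms(3) by (auto simp: span_singleton)
  then have "y = smul (m / k) x" using z by simp
  then show ?thesis using that by blast
qed

text \<open>Products and inverses of homogeneous units make the degrees with nonzero component a
  subgroup, and it contains the generating set \<open>gr_supp gr\<close>.\<close>

lemma gr_nonzero: "\<exists>x\<in>gr \<alpha>. x \<noteq> 0"
proof -
  interpret Z: module "zmul :: int \<Rightarrow> 'l \<Rightarrow> 'l" by (rule module_zmul)
  let ?S = "{\<alpha>. \<exists>x\<in>gr \<alpha>. x \<noteq> 0}"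
  have add: "\<alpha> + \<beta> \<in> ?S" if "\<alpha> \<in> ?S" "\<beta> \<in> ?S" for \<alpha> \<beta>
    using that mult_gr mult_nonzero by blast
  have neg: "- \<alpha> \<in> ?S" if "\<alpha> \<in> ?S" for \<alpha>
    using that unit_inv_gr unit_inv_nonzero by blast
  have zero: "0 \<in> ?S" using one_gr by (auto intro!: bexI[of _ 1])
  have "zmul n \<alpha> \<in> ?S" if "\<alpha> \<in> ?S" for n \<alpha>
  proof (induction n rule: int_induct[of _ 0])
    case base
    show ?case using zero by simp
  next
    case (step1 i)
    show ?case unfolding zmul_add_one by (rule add[OF that step1(2)])
  next
    case (step2 i)
    have "zmul (i - 1) \<alpha> = zmul i \<alpha> + - \<alpha>" by (simp add: zmul_diff_one)
    then show ?case using add[OF step2(2) neg[OF that]] by simp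
  qed
  then have "Z.subspace ?S" using add zero by (auto simp: Z.subspace_def)
  moreover have "gr_supp gr \<subseteq> ?S"
    using zero_gr by (auto simp: gr_supp_def)
  ultimately have "Z.span (gr_supp gr) \<subseteq> ?S" by (rule Z.span_minimal[rotated])
  then show ?thesis using supp_generates by auto
qed

end

section \<open>Commutation signs\<close>

definition msign :: "int \<Rightarrow> 'b::ab_group_add \<Rightarrow> 'b" where
  "msign n x = (if even n then x else - x)"

lemma msign_msign: "msign m (msign n x) = msign (m + n) x"
  by (auto simp: msign_def)

lemma msign_cong: "even (m - n) \<Longrightarrow> msign m x = msign n x"
  by (auto simp: msign_def)

lemma msign_add: "msign n (x + y) = msign n x + msign n y"
  by (auto simp: msign_def)

lemma msign_mult_left: "msign n x * y = msign n (x * (y :: 'b::ring_1))"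
  by (auto simp: msign_def)

lemma msign_mult_right: "y * msign n x = msign n (y * (x :: 'b::ring_1))"
  by (auto simp: msign_def)

text \<open>The integer power of \<open>w\<close>, with its inverse \<open>v\<close> passed as a
  parameter since \<open>'b\<close> is only a monoid.\<close>

definition upow :: "'b::monoid_mult \<Rightarrow> 'b \<Rightarrow> int \<Rightarrow> 'b" where
  "upow w v n = (if 0 \<le> n then w ^ nat n else v ^ nat (- n))"

lemma upow_0 [simp]: "upow w v 0 = 1"
  by (simp add: upow_def)

lemma upow_add_one:
  assumes "w * v = 1"
  shows "upow w v (n + 1) = w * upow w v n"
proof (cases "0 \<le> n")
  case True
  then show ?thesis by (simp add: upow_def nat_add_distrib)
next
  case False
  then have "nat (- n) = Suc (nat (- n - 1))" by simp
  moreover have "- (n + 1) = - n - 1" by simp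
  ultimately show ?thesis
    using False assms by (cases "n = - 1") (simp_all add: upow_def mult.assoc[symmetric])
qed

lemma upow_diff_one:
  assumes "w * v = 1" "v * w = 1"
  shows "upow w v (n - 1) = v * upow w v n"
  using upow_add_one[OF assms(1), of "n - 1"] assms(2) by (simp add: mult.assoc[symmetric])

lemma upow_add:
  assumes "w * v = 1" "v * w = 1"
  shows "upow w v (m + n) = upow w v m * upow w v n"
proof (induction m rule: int_induct[of _ 0])
  case (step1 i)
  have "i + 1 + n = (i + n) + 1" by simp
  then show ?case
    using step1 by (simp only: upow_add_one[OF assms(1)]) (simp add: mult.assoc)
next
  case (step2 i)
  have "i - 1 + n = (i + n) - 1" by simp
  then show ?case
    using step2 by (simp only: upow_diff_one[OF assms]) (simp add: mult.assoc)
qed simp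

section \<open>Integer-valued homomorphisms with prescribed parity\<close>

lemma additive_zmul:
  fixes b :: "'l::ab_group_add \<Rightarrow> int"
  assumes "\<And>x y. b (x + y) = b x + b y"
  shows "b (zmul n x) = n * b x"
proof (induction n rule: int_induct[of _ 0])
  case base
  show ?case using assms[of 0 0] by simp
next
  case (step1 i)
  then show ?case by (simp only: zmul_add_one assms) (simp add: algebra_simps)
next
  case (step2 i)
  have "zmul i x = zmul (i - 1) x + x" by (simp add: zmul_diff_one)
  then have "b (zmul i x) = b (zmul (i - 1) x) + b x" using assms by metis
  with step2 show ?case by (simp add: algebra_simps)
qed

text \<open>Reducing \<open>\<omega>\<close> modulo \<open>2\<Lambda>\<close> to a vector with coordinates \<open>0\<close> and \<open>1\<close> makes it
  primitive or zero, so that a lift of \<open>q\<close> can be corrected to vanish on it.\<close>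

lemma parity_lift:
  fixes q :: "'l::ab_group_add \<Rightarrow> int"
  assumes free: "fg_free_abelian TYPE('l)"
    and q_add: "\<And>\<alpha> \<beta>. even (q (\<alpha> + \<beta>) - q \<alpha> - q \<beta>)"
    and q_\<omega>: "even (q \<omega>)"
  obtains b \<theta> where "\<And>\<alpha> \<beta>. b (\<alpha> + \<beta>) = b \<alpha> + b \<beta>" "b (\<omega> - (\<theta> + \<theta>)) = (0 :: int)"
    "\<And>\<alpha>. even (b \<alpha> - q \<alpha>)"
proof -
  interpret Z: module "zmul :: int \<Rightarrow> 'l \<Rightarrow> 'l" by (rule module_zmul)
  obtain B :: "'l set" where B: "finite B" "Z.independent B" "Z.span B = UNIV"
    using free by (auto simp: fg_free_abelian_def)
  have rep_add: "Z.representation B (x + y) e = Z.representation B x e + Z.representation B y e" for x y e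
    using Z.representation_add[OF B(2)] B(3) by auto
  \<comment> \<open>Half of each coordinate of \<open>\<omega>\<close>, rounded down, so that
    \<open>\<delta>\<close> has coordinates 0 and 1.\<close>
  define \<theta> where "\<theta> = (\<Sum>e\<in>B. zmul (Z.representation B \<omega> e div 2) e)"
  define \<delta> where "\<delta> = \<omega> - (\<theta> + \<theta>)"
  have "Z.representation B \<theta> = (\<lambda>e. Z.representation B \<omega> e div 2)"
  proof (rule Z.representation_eqI[OF B(2)])
    show "e \<in> B" if "Z.representation B \<omega> e div 2 \<noteq> 0" for e
      using that Z.representation_ne_zero[of B \<omega> e] by fastforce
    then show "finite {e. Z.representation B \<omega> e div 2 \<noteq> 0}"
      using B(1) by (metis (mono_tags, lifting) mem_Collect_eq rev_finite_subset subsetI)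
    have "{e. Z.representation B \<omega> e div 2 \<noteq> 0} \<subseteq> B"
      using \<open>\<And>e. Z.representation B \<omega> e div 2 \<noteq> 0 \<Longrightarrow> e \<in> B\<close> by blast
    then show "(\<Sum>e | Z.representation B \<omega> e div 2 \<noteq> 0. zmul (Z.representation B \<omega> e div 2) e) = \<theta>"
      unfolding \<theta>_def by (intro sum.mono_neutral_left) (use B(1) in auto)
  qed (simp add: B(3))
  moreover have "\<omega> = \<delta> + (\<theta> + \<theta>)" by (simp add: \<delta>_def)
  ultimately have "Z.representation B \<omega> e = Z.representation B \<delta> e + 2 * (Z.representation B \<omega> e div 2)" for e
    using rep_add[of \<delta> "\<theta> + \<theta>" e] rep_add[of \<theta> \<theta> e] by simp
  then have rep_\<delta>: "Z.representation B \<delta> e = Z.representation B \<omega> e mod 2" for e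
    by (metis add_diff_cancel_right' minus_mult_div_eq_mod)
  \<comment> \<open>The linear extension of the values of \<open>q\<close> on the basis. Its parity
    agrees with \<open>q\<close> everywhere, because the elements where they agree form a subgroup
    containing \<open>B\<close>.\<close>
  define b where "b \<alpha> = (\<Sum>e\<in>B. Z.representation B \<alpha> e * q e)" for \<alpha>
  have b_add: "b (\<alpha> + \<beta>) = b \<alpha> + b \<beta>" for \<alpha> \<beta>
    by (simp add: b_def rep_add algebra_simps sum.distrib)
  have b_parity: "even (b \<alpha> - q \<alpha>)" for \<alpha>
  proof -
    have "b e = q e" if "e \<in> B" for e
    proof -
      have "b e = (\<Sum>e'\<in>B. if e' = e then q e' else 0)"
        unfolding b_def Z.representation_basis[OF B(2) that] by (intro sum.cong) auto
      then show ?thesis using B(1) that by simp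
    qed
    then have sub: "B \<subseteq> {\<alpha>. even (b \<alpha> - q \<alpha>)}" by auto
    have 0: "even (b 0 - q 0)" using q_add[of 0 0] b_add[of 0 0] by simp
    have add: "even (b (x + y) - q (x + y))" if "even (b x - q x)" "even (b y - q y)" for x y
      using q_add[of x y] b_add[of x y] that by presburger
    have neg: "even (b (- x) - q (- x))" if "even (b x - q x)" for x
      using q_add[of x "- x"] b_add[of x "- x"] that 0 by simp presburger
    have "even (b (zmul n x) - q (zmul n x))" if "even (b x - q x)" for n x
    proof (induction n rule: int_induct[of _ 0])
      case (step1 i)
      show ?case unfolding zmul_add_one by (rule add[OF that step1(2)])
    next
      case (step2 i)
      have "zmul (i - 1) x = zmul i x + - x" by (simp add: zmul_diff_one)
      then show ?case using add[OF step2(2) neg[OF that]] by simp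
    qed (use 0 in simp)
    then have "Z.subspace {\<alpha>. even (b \<alpha> - q \<alpha>)}"
      using 0 add by (auto simp: Z.subspace_def)
    from Z.span_minimal[OF sub this] show ?thesis using B(3) by auto
  qed
  \<comment> \<open>Modulo 2, \<open>q\<close> is additive and so vanishes on doubles; hence
    \<open>q \<delta>\<close> has the parity of \<open>q \<omega>\<close>.\<close>
  have "even (b \<delta>)"
  proof -
    have "q \<omega> = q (\<delta> + (\<theta> + \<theta>))" by (simp add: \<delta>_def)
    then have "even (q \<delta>)"
      using q_\<omega> q_add[of \<delta> "\<theta> + \<theta>"] q_add[of \<theta> \<theta>] by simp
    then show ?thesis using b_parity[of \<delta>] by simp
  qed
  show ?thesis
  proof (cases "\<exists>e. Z.representation B \<delta> e = 1")
    case True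
    then obtain e0 where e0: "Z.representation B \<delta> e0 = 1" by blast
    show ?thesis
    \<comment> \<open>The coordinate of \<open>\<delta>\<close> at \<open>e0\<close> is 1, so the
      subtracted term makes the value at \<open>\<delta>\<close> zero; it keeps parities because
      \<open>b \<delta>\<close> is even.\<close>
    proof (rule that[of "\<lambda>\<alpha>. b \<alpha> - Z.representation B \<alpha> e0 * b \<delta>" \<theta>])
      show "even (b \<alpha> - Z.representation B \<alpha> e0 * b \<delta> - q \<alpha>)" for \<alpha>
        using b_parity[of \<alpha>] \<open>even (b \<delta>)\<close> by simp
    qed (use e0 in \<open>simp_all add: b_add rep_add algebra_simps \<delta>_def[symmetric]\<close>)
  next
    case False
    then have "Z.representation B \<delta> e = 0" for e
      using rep_\<delta>[of e] by (metis mod2_eq_if)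
    then have "b \<delta> = 0" by (simp add: b_def)
    then show ?thesis using that[of b \<theta>] b_add b_parity by (simp add: \<delta>_def)
  qed
qed

section \<open>Involutions and commutation signs in characteristic 0\<close>

locale char_0_torus_inv = assoc_torus_inv smul gr \<iota>
  for smul :: "'f::field_char_0 \<Rightarrow> 'a::ring_1 \<Rightarrow> 'a"
    and gr :: "'l::ab_group_add \<Rightarrow> 'a set"
    and \<iota> :: "'a \<Rightarrow> 'a"
begin

lemma inv_add: "\<iota> (x + y) = \<iota> x + \<iota> y"
  using inv_linear by (simp add: Vector_Spaces.linear_iff)

lemma inv_smul: "\<iota> (smul c x) = smul c (\<iota> x)"
  using inv_linear by (simp add: Vector_Spaces.linear_iff)

lemma inv_zero [simp]: "\<iota> 0 = 0"
  using inv_add[of 0 0] by simp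

lemma inv_minus: "\<iota> (- x) = - \<iota> x"
  using inv_add[of x "- x"] by (simp add: eq_neg_iff_add_eq_0 add.commute)

lemma inv_one [simp]: "\<iota> 1 = 1"
  using inv_mult[of "\<iota> 1" 1] by (simp add: inv_inv)

lemma inv_msign: "\<iota> (msign n x) = msign n (\<iota> x)"
  by (simp add: msign_def inv_minus)

lemma inv_in_gr: "x \<in> gr \<alpha> \<Longrightarrow> \<iota> x \<in> gr \<alpha>"
  using inv_gr by blast

lemma two_torsion_free: "x + x = 0 \<Longrightarrow> x = 0" for x :: 'a
proof -
  assume "x + x = 0"
  moreover have "smul 2 x = x + x" using scale_left_distrib[of 1 1 x] by simp
  ultimately have "smul 2 x = 0" by simp
  then show ?thesis by (simp add: scale_eq_0_iff)
qed

text \<open>On the line \<open>gr \<alpha>\<close> the involution is a scalar whose square is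
  1.\<close>

lemma inv_homogeneous:
  assumes "x \<in> gr \<alpha>"
  shows "\<iota> x = x \<or> \<iota> x = - x"
proof (cases "x = 0")
  case False
  obtain k where k: "\<iota> x = smul k x"
    using gr_proportional[OF assms False inv_in_gr[OF assms]] by blast
  have "smul (k * k) x = smul 1 x"
    using inv_inv[of x] by (simp add: k inv_smul)
  then have "k * k = 1" using False by (simp only: scale_cancel_right) simp
  then have "k = 1 \<or> k = - 1" using square_eq_1_iff by blast
  then show ?thesis using k by auto
qed simp

text \<open>Each of \<open>x\<close>, \<open>y\<close> and \<open>x * y\<close> is hermitian or
  skew, while \<open>\<iota>\<close> reverses the product.\<close>

lemma commute_homogeneous:
  assumes "x \<in> gr \<alpha>" "y \<in> gr \<beta>"
  shows "x * y = y * x \<or> x * y = - (y * x)"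
  using inv_homogeneous[OF mult_gr[OF assms]] inv_homogeneous[OF assms(1)]
    inv_homogeneous[OF assms(2)] inv_mult[of x y] by force

text \<open>For homogeneous \<open>h\<close>, the exponent of the sign in
  \<open>h * x = \<plusminus> x * h\<close>; one exponent serves all of \<open>gr \<alpha>\<close>,
  as this space is a line.\<close>

definition comm_sign :: "'a \<Rightarrow> 'l \<Rightarrow> int" where
  "comm_sign h \<alpha> = (if \<forall>y\<in>gr \<alpha>. h * y = y * h then 0 else 1)"

lemma commute_comm_sign:
  assumes "h \<in> gr \<omega>" "x \<in> gr \<alpha>"
  shows "h * x = msign (comm_sign h \<alpha>) (x * h)"
proof (cases "\<forall>y\<in>gr \<alpha>. h * y = y * h")
  case True
  then show ?thesis using assms by (simp add: comm_sign_def msign_def)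
next
  case False
  then obtain y where y: "y \<in> gr \<alpha>" "h * y \<noteq> y * h" by blast
  then have "y \<noteq> 0" by auto
  then obtain k where k: "x = smul k y" using gr_proportional[OF y(1) _ assms(2)] by blast
  have "h * y = - (y * h)" using commute_homogeneous[OF assms(1) y(1)] y(2) by blast
  then have "h * x = - (x * h)"
    by (simp add: k smul_mult_left[symmetric] smul_mult_right[symmetric])
  then show ?thesis using False by (auto simp: comm_sign_def msign_def)
qed

text \<open>In characteristic 0 a nonzero element differs from its negative, so it detects the
  parity of an exponent.\<close>

lemma msign_inject: "x \<noteq> 0 \<Longrightarrow> msign m x = msign n x \<Longrightarrow> even (m - n)" for x :: 'a
  using two_torsion_free[of x]
  by (auto simp: msign_def split: if_splits) (metis add.right_inverse neg_equal_iff_equal)+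

text \<open>Moves \<open>h\<close> past a product one factor at a time. This is the additivity
  modulo 2 that \<open>parity_lift\<close> asks of \<open>q\<close>.\<close>

lemma comm_sign_add:
  assumes "h \<in> gr \<omega>" "h \<noteq> 0"
  shows "even (comm_sign h (\<alpha> + \<beta>) - comm_sign h \<alpha> - comm_sign h \<beta>)"
proof -
  obtain x y where x: "x \<in> gr \<alpha>" "x \<noteq> 0" and y: "y \<in> gr \<beta>" "y \<noteq> 0"
    using gr_nonzero by meson
  have "msign (comm_sign h (\<alpha> + \<beta>)) (x * y * h) = h * x * y"
    using commute_comm_sign[OF assms(1) mult_gr[OF x(1) y(1)]] by (simp add: mult.assoc)
  also have "\<dots> = msign (comm_sign h \<alpha>) (x * (h * y))"
    by (simp add: commute_comm_sign[OF assms(1) x(1)] msign_mult_left mult.assoc)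
  also have "\<dots> = msign (comm_sign h \<alpha> + comm_sign h \<beta>) (x * y * h)"
    by (simp add: commute_comm_sign[OF assms(1) y(1)] msign_mult_right mult.assoc msign_msign)
  finally have "even (comm_sign h (\<alpha> + \<beta>) - (comm_sign h \<alpha> + comm_sign h \<beta>))"
    using x y assms mult_nonzero mult_gr by (intro msign_inject[of "x * y * h"]) blast+
  then show ?thesis by (simp add: algebra_simps)
qed

lemma upow_gr:
  assumes "w \<in> gr \<delta>" "w \<noteq> 0"
  shows "upow w (unit_inv w) n \<in> gr (zmul n \<delta>) \<and> upow w (unit_inv w) n \<noteq> 0"
proof (induction n rule: int_induct[of _ 0])
  case (step1 i)
  then show ?case
    using mult_gr[OF assms(1)] mult_nonzero[OF assms]
    by (auto simp: upow_add_one[OF unit_inv_right[OF assms]] zmul_add_one)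
next
  case (step2 i)
  have "unit_inv w * upow w (unit_inv w) i \<in> gr (- \<delta> + zmul i \<delta>)"
    using mult_gr[OF unit_inv_gr[OF assms]] step2 by blast
  moreover have "unit_inv w * upow w (unit_inv w) i \<noteq> 0"
    using mult_nonzero(1)[OF unit_inv_gr[OF assms] unit_inv_nonzero[OF assms]] step2 by blast
  ultimately show ?case
    by (simp add: upow_diff_one[OF unit_inv_right[OF assms] unit_inv_left[OF assms]] zmul_diff_one)
qed (simp add: one_gr)

lemma inv_unit_inv:
  assumes "w \<in> gr \<delta>" "w \<noteq> 0" "\<iota> w = w"
  shows "\<iota> (unit_inv w) = unit_inv w"
proof -
  have "\<iota> (unit_inv w) * w = 1"
    using inv_mult[of w "unit_inv w"] unit_inv_right[OF assms(1,2)] assms(3) by simp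
  then have "\<iota> (unit_inv w) * (w * unit_inv w) = unit_inv w"
    by (simp add: mult.assoc[symmetric])
  then show ?thesis by (simp add: unit_inv_right[OF assms(1,2)])
qed

lemma inv_power: "\<iota> x = x \<Longrightarrow> \<iota> (x ^ n) = x ^ n"
  by (induction n) (simp_all add: inv_mult power_commutes)

lemma inv_upow:
  assumes "w \<in> gr \<delta>" "w \<noteq> 0" "\<iota> w = w"
  shows "\<iota> (upow w (unit_inv w) n) = upow w (unit_inv w) n"
  by (simp add: upow_def inv_power assms(3) inv_unit_inv[OF assms])

lemma commute_upow:
  assumes "w \<in> gr \<delta>" "w \<noteq> 0" "w * x = msign k (x * w)"
  shows "upow w (unit_inv w) n * x = msign (n * k) (x * upow w (unit_inv w) n)"
proof (induction n rule: int_induct[of _ 0])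
  case base
  show ?case by (simp add: msign_def)
next
  case (step1 i)
  let ?u = "upow w (unit_inv w) i"
  have "w * ?u * x = msign (i * k) (w * x * ?u)"
    by (simp add: mult.assoc step1(2) msign_mult_right)
  also have "\<dots> = msign (i * k + k) (x * w * ?u)"
    by (simp only: assms(3) msign_mult_left msign_msign)
  finally show ?case
    by (simp add: upow_add_one[OF unit_inv_right[OF assms(1,2)]] mult.assoc distrib_right)
next
  case (step2 i)
  let ?u = "upow w (unit_inv w) i" and ?v = "unit_inv w"
  \<comment> \<open>Signs are their own inverses, so moving the inverse of \<open>w\<close> past
    \<open>x\<close> costs the same sign as moving \<open>w\<close>.\<close>
  have "?v * x = ?v * (x * w) * ?v"
    by (simp add: mult.assoc unit_inv_right[OF assms(1,2)])
  also have "x * w = msign k (w * x)"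
    by (simp only: assms(3) msign_msign) (simp add: msign_def)
  finally have "?v * x = msign k (?v * (w * x) * ?v)"
    by (simp only: msign_mult_right msign_mult_left)
  also have "?v * (w * x) = x"
    by (simp add: mult.assoc[symmetric] unit_inv_left[OF assms(1,2)])
  finally have v: "?v * x = msign k (x * ?v)" .
  have "?v * ?u * x = msign (i * k) (?v * x * ?u)"
    by (simp add: mult.assoc step2(2) msign_mult_right)
  also have "\<dots> = msign (i * k + k) (x * ?v * ?u)"
    by (simp only: v msign_mult_left msign_msign)
  also have "\<dots> = msign ((i - 1) * k) (x * ?v * ?u)"
    by (rule msign_cong) (simp add: algebra_simps)
  finally show ?case
    by (simp add: upow_diff_one[OF unit_inv_right[OF assms(1,2)] unit_inv_left[OF assms(1,2)]]
        mult.assoc)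
qed

end

section \<open>Removing a hermitian twist of the involution\<close>

definition triangle :: "int \<Rightarrow> int" where
  "triangle n = n * (n - 1) div 2"

text \<open>The defect of additivity is \<open>m * n\<close>, which is the exponent produced when an
  \<open>m\<close>-th power of \<open>w\<close> passes an element of degree \<open>\<beta>\<close>
  with \<open>b \<beta> = n\<close>; this makes the signs in \<open>hermitian_twist\<close>
  multiplicative.\<close>

lemma triangle_add: "triangle (m + n) = triangle m + triangle n + m * n"
proof -
  have 2: "2 * triangle n = n * (n - 1)" for n
    unfolding triangle_def by (rule dvd_mult_div_cancel) simp
  have "2 * triangle (m + n) = 2 * (triangle m + triangle n + m * n)"
    by (simp only: 2 distrib_left) (simp add: algebra_simps)
  then show ?thesis by simp
qed

context char_0_torus_inv
begin

text \<open>The grading automorphism is the transvection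
  \<open>\<alpha> \<mapsto> \<alpha> + b(\<alpha>) \<delta>\<close>; the factor \<open>(-1)\<^bsup>b(b-1)/2\<^esup>\<close> absorbs the signs that arise from
  commuting \<open>w \<in> A\<^sup>\<delta>\<close> past homogeneous elements.\<close>

lemma hermitian_twist:
  assumes free: "fg_free_abelian TYPE('l)"
    and h: "h \<in> gr \<omega>" "h \<noteq> 0" "\<iota> h = h"
  obtains \<psi> T where "bij \<psi>" "Vector_Spaces.linear smul smul \<psi>" "\<And>x y. \<psi> (x * y) = \<psi> x * \<psi> y"
    "\<psi> 1 = 1" "\<And>x. \<psi> (h * \<iota> x * unit_inv h) = \<iota> (\<psi> x)"
    "group_iso_on UNIV UNIV T" "\<And>\<alpha>. \<psi> ` gr \<alpha> = gr (T \<alpha>)"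
proof -
  \<comment> \<open>The unit \<open>h\<close> commutes with itself, which is the condition on
    \<open>\<omega>\<close> in \<open>parity_lift\<close>.\<close>
  have even_\<omega>: "even (comm_sign h \<omega>)"
  proof -
    have "msign (comm_sign h \<omega>) (h * h) = msign 0 (h * h)"
      using commute_comm_sign[OF h(1) h(1)] by (simp add: msign_def)
    then show ?thesis using msign_inject[OF mult_nonzero(1)[OF h(1,2) h(2)]] by fastforce
  qed
  obtain b \<theta> where b_add: "\<And>\<alpha> \<beta>. b (\<alpha> + \<beta>) = b \<alpha> + b \<beta>"
    and b0: "b (\<omega> - (\<theta> + \<theta>)) = 0" and b_parity: "\<And>\<alpha>. even (b \<alpha> - comm_sign h \<alpha>)"
    using parity_lift[OF free comm_sign_add[OF h(1,2)] even_\<omega>] by blast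
  have h_comm: "h * x = msign (b \<alpha>) (x * h)" if "x \<in> gr \<alpha>" for x \<alpha>
    using commute_comm_sign[OF h(1) that] msign_cong[OF b_parity[of \<alpha>]] by metis
  define \<delta> where "\<delta> = \<omega> - (\<theta> + \<theta>)"
  obtain z where z: "z \<in> gr (- \<theta>)" "z \<noteq> 0" using gr_nonzero by blast
  \<comment> \<open>The square of \<open>z\<close> is central, so it moves the degree of
    \<open>h\<close> to \<open>\<delta>\<close>, where \<open>b\<close> vanishes, without changing
    the commutation signs.\<close>
  define w where "w = h * (z * z)"
  have zz_comm: "z * z * x = x * (z * z)" if "x \<in> gr \<alpha>" for x \<alpha>
    using commute_homogeneous[OF z(1) that]
  proof
    assume "z * x = - (x * z)"
    then have "z * (z * x) = x * z * z" by (metis mult.assoc minus_minus mult_minus_left mult_minus_right)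
    then show ?thesis by (simp add: mult.assoc)
  qed (metis mult.assoc)
  have w: "w \<in> gr \<delta>" "w \<noteq> 0"
    unfolding w_def using mult_gr[OF h(1) mult_gr[OF z(1) z(1)]] mult_nonzero(1)[OF h(1,2)]
      mult_nonzero(1)[OF z z(2)] by (auto simp: \<delta>_def algebra_simps)
  \<comment> \<open>Either sign of \<open>\<iota> z\<close> disappears in the square, and the square
    commutes with \<open>h\<close>.\<close>
  have \<iota>_w: "\<iota> w = w"
    using inv_homogeneous[OF z(1)] zz_comm[OF h(1)] by (auto simp: w_def inv_mult h(3))
  have w_comm: "w * x = msign (b \<alpha>) (x * w)" if "x \<in> gr \<alpha>" for x \<alpha>
    using h_comm[OF that] zz_comm[OF that]
    by (simp add: w_def mult.assoc msign_mult_left msign_mult_right)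
       (simp add: mult.assoc[symmetric] msign_mult_left)
  note w_units = unit_inv_right[OF w] unit_inv_left[OF w]
  define W where "W n = upow w (unit_inv w) n" for n
  have W_comm: "W n * x = msign (n * b \<alpha>) (x * W n)" if "x \<in> gr \<alpha>" for n x \<alpha>
    unfolding W_def by (rule commute_upow[OF w w_comm[OF that]])
  have W_add: "W (m + n) = W m * W n" for m n
    unfolding W_def by (rule upow_add[OF w_units])
  have W_0 [simp]: "W 0 = 1" by (simp add: W_def)
  have W_gr: "W n \<in> gr (zmul n \<delta>)" for n using upow_gr[OF w] by (simp add: W_def)
  have W_inv: "W (- n) * W n = 1" "W n * W (- n) = 1" for n
    using W_add[of "- n" n] W_add[of n "- n"] by simp_all
  have \<iota>_W: "\<iota> (W n) = W n" for n
    unfolding W_def by (rule inv_upow[OF w \<iota>_w])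
  define g where "g \<alpha> x = msign (triangle (b \<alpha>)) (x * W (b \<alpha>))" for \<alpha> x
  define \<psi> where "\<psi> = hextend g"
  define T where "T \<alpha> = \<alpha> + zmul (b \<alpha>) \<delta>" for \<alpha>
  have g0: "g \<alpha> 0 = 0" for \<alpha> by (simp add: g_def msign_def)
  have g_add: "g \<alpha> (x + y) = g \<alpha> x + g \<alpha> y" for \<alpha> x y
    by (simp add: g_def algebra_simps msign_add)
  have g_smul: "g \<alpha> (smul c x) = smul c (g \<alpha> x)" for \<alpha> c x
    by (simp add: g_def smul_mult_left[symmetric] msign_def)
  have \<psi>_hom: "\<psi> x = g \<alpha> x" if "x \<in> gr \<alpha>" for x \<alpha>
    unfolding \<psi>_def by (rule hextend_homogeneous[of g, OF g0 that])
  have \<psi>_add: "\<psi> (x + y) = \<psi> x + \<psi> y" for x y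
    unfolding \<psi>_def by (rule hextend_add[of g, OF g_add])
  have \<psi>_smul: "\<psi> (smul c x) = smul c (\<psi> x)" for c x
    unfolding \<psi>_def by (rule hextend_smul[of g, OF g_smul g0 module_axioms])
  have \<psi>_linear: "Vector_Spaces.linear smul smul \<psi>"
    using \<psi>_add \<psi>_smul vector_space_axioms by (simp add: Vector_Spaces.linear_iff)
  have g_gr: "g \<alpha> x \<in> gr (T \<alpha>)" if "x \<in> gr \<alpha>" for x \<alpha>
    using mult_gr[OF that W_gr[of "b \<alpha>"]] minus_gr by (auto simp: g_def T_def msign_def)
  have b_zmul: "b (zmul n x) = n * b x" for n x
    by (rule additive_zmul[of b, OF b_add])
  \<comment> \<open>From \<open>b \<delta> = 0\<close> it follows that \<open>T\<close> preserves
    \<open>b\<close>. Hence the amount by which \<open>T\<close> moves a degree can be read off from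
    the image, and \<open>T\<close> is invertible.\<close>
  have b_T: "b (T \<alpha>) = b \<alpha>" for \<alpha>
    using b0 by (simp add: T_def b_add b_zmul \<delta>_def)
  have T_add: "T (x + y) = T x + T y" for x y
    by (simp add: T_def b_add zmul_add_left algebra_simps)
  have inj_T: "inj T"
    by (rule injI) (metis T_def b_T add_right_cancel)
  have "T (\<alpha> - zmul (b \<alpha>) \<delta>) = \<alpha>" for \<alpha>
  proof -
    have "b (\<alpha> - zmul (b \<alpha>) \<delta>) = b \<alpha>"
      using b_add[of "\<alpha> - zmul (b \<alpha>) \<delta>" "zmul (b \<alpha>) \<delta>"] b0 by (simp add: b_zmul \<delta>_def)
    then show ?thesis by (simp add: T_def)
  qed
  then have surj_T: "surj T" by (rule surjI)
  have T_iso: "group_iso_on UNIV UNIV T"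
    using inj_T surj_T T_add by (simp add: group_iso_on_def group_hom_on_def bij_def)
  have \<psi>_gr: "\<psi> ` gr \<alpha> = gr (T \<alpha>)" for \<alpha>
  proof
    show "\<psi> ` gr \<alpha> \<subseteq> gr (T \<alpha>)" using \<psi>_hom g_gr by auto
    show "gr (T \<alpha>) \<subseteq> \<psi> ` gr \<alpha>"
    proof
      fix y assume y: "y \<in> gr (T \<alpha>)"
      \<comment> \<open>Undoes \<open>g \<alpha>\<close>: the opposite power of \<open>w\<close>
        cancels, and the sign is its own inverse.\<close>
      define x where "x = msign (triangle (b \<alpha>)) (y * W (- b \<alpha>))"
      have "zmul (b \<alpha>) \<delta> + zmul (- b \<alpha>) \<delta> = 0"
        by (simp add: zmul_add_left[symmetric])
      then have "T \<alpha> + zmul (- b \<alpha>) \<delta> = \<alpha>" by (simp add: T_def add.assoc)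
      then have x: "x \<in> gr \<alpha>"
        using mult_gr[OF y W_gr[of "- b \<alpha>"]] minus_gr by (auto simp: x_def msign_def)
      have "g \<alpha> x = y"
        by (simp add: g_def x_def msign_mult_left msign_msign mult.assoc W_inv) (simp add: msign_def)
      then show "y \<in> \<psi> ` gr \<alpha>" using \<psi>_hom[OF x] x by force
    qed
  qed
  have "inj \<psi>"
  proof (rule injI)
    fix x y assume "\<psi> x = \<psi> y"
    moreover have "\<psi> x = \<psi> (x - y) + \<psi> y" using \<psi>_add[of "x - y" y] by simp
    ultimately have *: "(\<Sum>\<alpha> | hcomp (x - y) \<alpha> \<noteq> 0. g \<alpha> (hcomp (x - y) \<alpha>)) = 0"
      by (simp add: \<psi>_def hextend_def)
    have "hcomp (x - y) \<alpha> = 0" for \<alpha>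
    proof (rule ccontr)
      assume nz: "hcomp (x - y) \<alpha> \<noteq> 0"
      \<comment> \<open>The terms lie in the distinct degrees \<open>T \<alpha>\<close>, so a
        vanishing sum forces each of them to vanish.\<close>
      have "g \<alpha> (hcomp (x - y) \<alpha>) = 0"
        by (rule gr_independent[where c = "\<lambda>\<alpha>. g \<alpha> (hcomp (x - y) \<alpha>)" and d = T,
              OF finite_hcomp _ _ *])
           (use nz inj_T in \<open>auto intro: inj_on_subset g_gr hcomp_gr\<close>)
      then have "hcomp (x - y) \<alpha> * W (b \<alpha>) * W (- b \<alpha>) = 0"
        by (simp add: g_def msign_def split: if_splits)
      then show False using nz by (simp add: mult.assoc W_inv)
    qed
    then have "x - y = 0" using sum_hcomp[of "x - y"] by simp
    then show "x = y" by simp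
  qed
  moreover have "surj \<psi>"
  proof -
    have "y \<in> range \<psi>" for y
    proof (induction y rule: homogeneous_induct)
      case (1 \<alpha> x)
      obtain \<beta> where "\<alpha> = T \<beta>" using surj_T by blast
      then show ?case using 1 \<psi>_gr[of \<beta>] by blast
    next
      case (2 x y)
      then obtain u v where "x = \<psi> u" "y = \<psi> v" by blast
      then have "x + y = \<psi> (u + v)" by (simp add: \<psi>_add)
      then show ?case by blast
    qed
    then show ?thesis by blast
  qed
  ultimately have bij: "bij \<psi>" by (simp add: bij_def)
  have \<psi>_mult_hom: "\<psi> (x * y) = \<psi> x * \<psi> y" if x: "x \<in> gr \<alpha>" and y: "y \<in> gr \<beta>" for x y \<alpha> \<beta>
  proof -
    have "\<psi> x * \<psi> y = msign (triangle (b \<alpha>) + triangle (b \<beta>)) (x * (W (b \<alpha>) * y) * W (b \<beta>))"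
      by (simp add: \<psi>_hom[OF x] \<psi>_hom[OF y] g_def msign_mult_left msign_mult_right msign_msign
          mult.assoc add.commute)
    \<comment> \<open>Passing \<open>W (b \<alpha>)\<close> over \<open>y\<close> contributes
      \<open>b \<alpha> * b \<beta>\<close>, the term missing from the triangle of the sum.\<close>
    also have "\<dots> = msign (triangle (b \<alpha> + b \<beta>)) (x * y * W (b \<alpha> + b \<beta>))"
      by (simp add: W_comm[OF y] msign_mult_left msign_mult_right msign_msign mult.assoc W_add
          triangle_add)
    also have "\<dots> = \<psi> (x * y)"
      by (simp add: \<psi>_hom[OF mult_gr[OF x y]] g_def b_add)
    finally show ?thesis by simp
  qed
  have \<psi>_mult: "\<psi> (x * y) = \<psi> x * \<psi> y" for x y
  proof (induction x rule: homogeneous_induct)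
    case (1 \<alpha> x)
    show ?case
      by (induction y rule: homogeneous_induct)
         (simp_all add: \<psi>_mult_hom[OF 1] \<psi>_add algebra_simps)
  qed (simp add: \<psi>_add algebra_simps)
  have b_zero: "b 0 = 0" using b_add[of 0 0] by simp
  have \<psi>_one: "\<psi> 1 = 1"
    using \<psi>_hom[OF one_gr] by (simp add: g_def b_zero triangle_def msign_def)
  have \<psi>_inv: "\<psi> (h * \<iota> x * unit_inv h) = \<iota> (\<psi> x)" for x
  proof (induction x rule: homogeneous_induct)
    case (1 \<alpha> x)
    note x = inv_in_gr[OF 1]
    have "h * \<iota> x * unit_inv h = msign (b \<alpha>) (\<iota> x)"
      by (simp add: h_comm[OF x] msign_mult_left mult.assoc unit_inv_right[OF h(1,2)])
    moreover have "msign (b \<alpha>) (\<iota> x) \<in> gr \<alpha>" using x minus_gr by (auto simp: msign_def)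
    ultimately have "\<psi> (h * \<iota> x * unit_inv h) = msign (triangle (b \<alpha>) + b \<alpha>) (\<iota> x * W (b \<alpha>))"
      by (simp add: \<psi>_hom g_def msign_mult_left msign_msign)
    \<comment> \<open>Conjugation by \<open>h\<close> gives the exponent \<open>b \<alpha>\<close>,
      and reversing the product with \<open>W (b \<alpha>)\<close> gives its square; an integer and
      its square have the same parity.\<close>
    also have "\<dots> = msign (triangle (b \<alpha>) + b \<alpha> * b \<alpha>) (\<iota> x * W (b \<alpha>))"
      by (rule msign_cong) simp
    also have "\<dots> = \<iota> (\<psi> x)"
      by (simp add: \<psi>_hom[OF 1] g_def inv_msign inv_mult \<iota>_W W_comm[OF x] msign_msign)
    finally show ?case .
  next
    case (2 x y)
    then show ?case by (simp add: inv_add \<psi>_add algebra_simps)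
  qed
  show ?thesis using that[OF bij \<psi>_linear \<psi>_mult \<psi>_one \<psi>_inv T_iso \<psi>_gr] .
qed

end

section \<open>Signed indices and the roots of type C\<close>

text \<open>The index \<open>Inl i\<close> of rows and columns has weight \<open>\<epsilon>\<^sub>i\<close> and \<open>Inr i\<close> has weight \<open>-\<epsilon>\<^sub>i\<close>;
  then every nonzero root is a difference of two weights.\<close>

definition base :: "'r + 'r \<Rightarrow> 'r" where
  "base = case_sum id id"

definition star :: "'r + 'r \<Rightarrow> 'r + 'r" where
  "star = case_sum Inr Inl"

text \<open>The sign of the weight as an exponent for \<open>msign\<close>; it also governs the
  signs in \<open>rvec\<close>.\<close>

definition isg :: "'r + 'r \<Rightarrow> int" where
  "isg = case_sum (\<lambda>_. 0) (\<lambda>_. 1)"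

definition wt :: "'r::finite + 'r \<Rightarrow> int^'r" where
  "wt = case_sum eps (\<lambda>i. - eps i)"

lemma signed_index_simps [simp]:
  "base (Inl i) = i" "base (Inr i) = i" "star (Inl i) = Inr i" "star (Inr i) = Inl i"
  "isg (Inl i) = 0" "isg (Inr i) = 1"
  by (simp_all add: base_def star_def isg_def)

lemma wt_simps [simp]: "wt (Inl i) = eps i" "wt (Inr i) = - eps i"
  by (simp_all add: wt_def)

lemma star_star [simp]: "star (star p) = p"
  by (cases p) auto

lemma base_star [simp]: "base (star p) = base p"
  by (cases p) auto

lemma star_neq [simp]: "star p \<noteq> p" "p \<noteq> star p"
  unfolding star_def by (auto split: sum.splits)

lemma star_eq_iff: "star p = q \<longleftrightarrow> p = star q"
  by (metis star_star)

lemma star_inject [simp]: "star p = star q \<longleftrightarrow> p = q"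
  by (metis star_star)

lemma base_eq_iff: "base p = base q \<longleftrightarrow> p = q \<or> p = star q"
  by (cases p; cases q) auto

lemma wt_star [simp]: "wt (star p) = - wt p"
  by (cases p) auto

lemma isg_star: "isg (star p) = 1 - isg p"
  by (cases p) auto

lemma wt_nth: "wt p $ i = (if base p = i then msign (isg p) 1 else 0)"
  by (cases p) (auto simp: eps_def axis_def msign_def)

lemma wt_nth_cases:
  "(wt p $ i = 0 \<and> base p \<noteq> i) \<or> (wt p $ i = 1 \<and> p = Inl i) \<or> (wt p $ i = - 1 \<and> p = Inr i)"
  by (cases p) (auto simp: eps_def axis_def)

lemma wt_inject: "wt p = wt q \<longleftrightarrow> p = q"
  using wt_nth_cases[of p "base p"] wt_nth_cases[of q "base p"] by auto

text \<open>Look at coordinate \<open>base p\<close>: there \<open>wt p\<close> is 1 or -1 and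
  \<open>wt a\<close> cannot cancel it, so \<open>c\<close> or \<open>d\<close> must be
  \<open>p\<close>. The other summand follows by cancellation.\<close>

lemma wt_add_eq:
  assumes "a \<noteq> star p" "wt p + wt a = wt c + wt d"
  shows "(c = p \<and> d = a) \<or> (c = a \<and> d = p)"
proof -
  let ?i = "base p"
  have "wt p $ ?i + wt a $ ?i = wt c $ ?i + wt d $ ?i"
    using assms(2) by (metis vector_add_component)
  moreover have "wt a $ ?i = 0 \<or> a = p"
    using assms(1) wt_nth_cases[of a ?i] base_eq_iff[of a p] by auto
  moreover have "wt p $ ?i = 1 \<and> p = Inl ?i \<or> wt p $ ?i = - 1 \<and> p = Inr ?i"
    using wt_nth_cases[of p ?i] by auto
  ultimately have "c = p \<or> d = p"
    using wt_nth_cases[of c ?i] wt_nth_cases[of d ?i] by (smt (verit))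
  then show ?thesis
    using assms(2) wt_inject by (metis add.commute add_left_cancel)
qed

text \<open>Writing the difference as the sum of \<open>wt p\<close> and \<open>wt (star q)\<close>,
  only the order of the summands is ambiguous.\<close>

lemma wt_diff_eq:
  assumes "p \<noteq> q" "wt p - wt q = wt p' - wt q'"
  shows "(p' = p \<and> q' = q) \<or> (p' = star q \<and> q' = star p)"
proof -
  have "(p' = p \<and> star q' = star q) \<or> (p' = star q \<and> star q' = p)"
    by (rule wt_add_eq) (use assms in auto)
  then show ?thesis by (metis star_star)
qed

section \<open>Roots and root-preserving automorphisms of the root lattice\<close>

definition nonzero_root :: "int^'r::finite \<Rightarrow> bool" where
  "nonzero_root \<beta> \<longleftrightarrow> (\<exists>p q. p \<noteq> q \<and> \<beta> = wt p - wt q)"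

lemma nonzero_root_iff: "nonzero_root \<beta> \<longleftrightarrow> \<beta> \<in> roots \<and> \<beta> \<noteq> 0"
proof
  assume "nonzero_root \<beta>"
  then obtain p q where pq: "p \<noteq> q" "\<beta> = wt p - wt q" by (auto simp: nonzero_root_def)
  then have "\<beta> \<noteq> 0" by (simp add: wt_inject)
  moreover have "\<beta> \<in> roots"
  proof (cases p)
    case (Inl i)
    then show ?thesis using pq by (cases q) (auto simp: roots_def)
  next
    case (Inr i)
    show ?thesis
    proof (cases q)
      case (Inl j)
      have "\<beta> = - (eps i + eps j)" using Inl Inr pq by simp
      then show ?thesis by (auto simp: roots_def)
    next
      case (Inr j)
      have "\<beta> = eps j - eps i" "i \<noteq> j" using Inr \<open>p = Inr i\<close> pq by simp_all
      then show ?thesis unfolding roots_def by blast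
    qed
  qed
  ultimately show "\<beta> \<in> roots \<and> \<beta> \<noteq> 0" by simp
next
  assume "\<beta> \<in> roots \<and> \<beta> \<noteq> 0"
  then consider i j where "i \<noteq> j" "\<beta> = eps i - eps j" | i j where "\<beta> = eps i + eps j"
    | i j where "\<beta> = - (eps i + eps j)"
    by (auto simp: roots_def)
  then show "nonzero_root \<beta>"
  proof cases
    case 1
    then show ?thesis
      unfolding nonzero_root_def by (intro exI[of _ "Inl i"] exI[of _ "Inl j"]) auto
  next
    case 2
    then show ?thesis
      unfolding nonzero_root_def by (intro exI[of _ "Inl i"] exI[of _ "Inr j"]) auto
  next
    case 3
    then show ?thesis
      unfolding nonzero_root_def by (intro exI[of _ "Inr i"] exI[of _ "Inl j"]) auto
  qed
qed

lemma nonzero_root_bound: "nonzero_root \<beta> \<Longrightarrow> \<bar>\<beta> $ i\<bar> \<le> 2"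
  unfolding nonzero_root_def
proof (elim exE conjE)
  fix p q assume "\<beta> = wt p - wt q"
  then show ?thesis using wt_nth_cases[of p i] wt_nth_cases[of q i] by auto
qed

lemma nonzero_root_concentrated:
  assumes "nonzero_root \<beta>" "\<bar>\<beta> $ i\<bar> = 2" "j \<noteq> i"
  shows "\<beta> $ j = 0"
proof -
  obtain p q where pq: "\<beta> = wt p - wt q" using assms(1) by (auto simp: nonzero_root_def)
  then show ?thesis
    using wt_nth_cases[of p i] wt_nth_cases[of q i] wt_nth_cases[of p j] wt_nth_cases[of q j]
      assms(2,3) by auto
qed

text \<open>The long roots \<open>\<beta>\<close> are those for which no nonzero root \<open>\<gamma>\<close> makes both \<open>\<beta> \<plusminus> \<gamma>\<close> nonzero roots.\<close>

lemma long_root_no_string: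
  assumes "nonzero_root \<gamma>" "nonzero_root (wt p - wt (star p) + \<gamma>)"
    "nonzero_root (wt p - wt (star p) - \<gamma>)"
  shows False
proof -
  let ?i = "base p"
  have p: "\<bar>wt p $ ?i\<bar> = 1" using wt_nth_cases[of p ?i] by auto
  have \<gamma>0: "\<gamma> $ ?i = 0"
    using nonzero_root_bound[OF assms(2), of ?i] nonzero_root_bound[OF assms(3), of ?i] p by simp
  have "\<gamma> $ j = 0" for j
  proof (cases "j = ?i")
    case False
    have "\<bar>(wt p - wt (star p) + \<gamma>) $ ?i\<bar> = 2" using p \<gamma>0 by simp
    from nonzero_root_concentrated[OF assms(2) this False] show ?thesis
      using False by (simp add: wt_nth)
  qed (use \<gamma>0 in simp)
  then have "\<gamma> = 0" by (simp add: vec_eq_iff)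
  then show False using assms(1) by (simp add: nonzero_root_iff)
qed

lemma short_root_string:
  assumes "base p \<noteq> base q"
  shows "\<exists>\<gamma>. nonzero_root \<gamma> \<and> nonzero_root (wt p - wt q + \<gamma>) \<and> nonzero_root (wt p - wt q - \<gamma>)"
\<comment> \<open>The witness is \<open>wt p + wt q\<close>: adding it gives the long root
  \<open>2 wt p\<close>, subtracting it the long root \<open>-2 wt q\<close>.\<close>
proof (intro exI[of _ "wt p - wt (star q)"] conjI)
  show "nonzero_root (wt p - wt (star q))"
    using assms unfolding nonzero_root_def by (metis base_star)
  have "wt p - wt q + (wt p - wt (star q)) = wt p - wt (star p)" by simp
  then show "nonzero_root (wt p - wt q + (wt p - wt (star q)))"
    unfolding nonzero_root_def by (metis star_neq(1))
  have "wt p - wt q - (wt p - wt (star q)) = wt (star q) - wt q" by simp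
  then show "nonzero_root (wt p - wt q - (wt p - wt (star q)))"
    unfolding nonzero_root_def by (metis star_neq(1))
qed

lemma wt_diff_in_root_lattice: "wt p - wt q \<in> root_lattice"
proof -
  interpret Z: module "zmul :: int \<Rightarrow> int^'a \<Rightarrow> int^'a" by (rule module_zmul)
  have "wt p - wt q \<in> roots"
    using nonzero_root_iff[of "wt p - wt q"] by (cases "p = q") (auto simp: nonzero_root_def roots_def)
  then show ?thesis unfolding root_lattice_def by (rule Z.span_base)
qed

lemma
  assumes "x \<in> root_lattice" "y \<in> root_lattice"
  shows add_in_root_lattice: "x + y \<in> root_lattice"
    and diff_in_root_lattice: "x - y \<in> root_lattice"
proof -
  interpret Z: module "zmul :: int \<Rightarrow> int^'a \<Rightarrow> int^'a" by (rule module_zmul)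
  show "x + y \<in> root_lattice" "x - y \<in> root_lattice"
    using assms Z.span_add Z.span_diff unfolding root_lattice_def by blast+
qed

lemma zero_in_root_lattice: "0 \<in> root_lattice"
  using wt_diff_in_root_lattice[of p p for p] by simp

text \<open>The additive criterion for long roots is invariant under \<open>f\<close>, so
  \<open>f\<close> maps long roots to long roots. A long root is twice a weight, which defines
  \<open>\<tau>\<close>; the remaining values follow by halving.\<close>

lemma root_lattice_automorphism:
  fixes f :: "int^'r::finite \<Rightarrow> int^'r"
  assumes iso: "group_iso_on root_lattice root_lattice f"
    and roots: "\<And>\<beta>. \<beta> \<in> root_lattice \<Longrightarrow> nonzero_root (f \<beta>) \<longleftrightarrow> nonzero_root \<beta>"
  obtains \<tau> where "\<And>p. \<tau> (star p) = star (\<tau> p)"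
    "\<And>p q. base p \<noteq> base q \<Longrightarrow> base (\<tau> p) \<noteq> base (\<tau> q)"
    "\<And>p q. f (wt p - wt q) = wt (\<tau> p) - wt (\<tau> q)"
proof -
  have add: "f (x + y) = f x + f y" if "x \<in> root_lattice" "y \<in> root_lattice" for x y
    using iso that by (auto simp: group_iso_on_def group_hom_on_def)
  have diff: "f (x - y) = f x - f y" if "x \<in> root_lattice" "y \<in> root_lattice" for x y
    using add[OF diff_in_root_lattice[OF that] that(2)] by simp
  have surj: "f ` root_lattice = root_lattice" and inj: "inj_on f root_lattice"
    using iso by (auto simp: group_iso_on_def bij_betw_def)
  let ?L = "\<lambda>p :: 'r + 'r. wt p - wt (star p)"
  have "\<exists>p'. f (?L p) = ?L p'" for p
  proof -
    have L: "?L p \<in> root_lattice" by (rule wt_diff_in_root_lattice)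
    have "nonzero_root (?L p)" unfolding nonzero_root_def by (metis star_neq(2))
    then have "nonzero_root (f (?L p))" using roots[OF L] by simp
    then obtain a b where ab: "a \<noteq> b" "f (?L p) = wt a - wt b" by (auto simp: nonzero_root_def)
    have "base a = base b"
    proof (rule ccontr)
      \<comment> \<open>The image would be a short root, and its string would pull back along
        \<open>f\<close> to one through a long root.\<close>
      assume "base a \<noteq> base b"
      then obtain \<gamma>' where \<gamma>': "nonzero_root \<gamma>'" "nonzero_root (f (?L p) + \<gamma>')"
        "nonzero_root (f (?L p) - \<gamma>')"
        using short_root_string unfolding ab(2) by blast
      have "\<gamma>' \<in> root_lattice"
        using \<gamma>'(1) wt_diff_in_root_lattice by (auto simp: nonzero_root_def)
      then obtain \<gamma> where \<gamma>: "\<gamma> \<in> root_lattice" "\<gamma>' = f \<gamma>" using surj by blast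
      have "nonzero_root \<gamma>" "nonzero_root (?L p + \<gamma>)" "nonzero_root (?L p - \<gamma>)"
        using \<gamma>' roots[OF \<gamma>(1)] roots[OF add_in_root_lattice[OF L \<gamma>(1)]]
          roots[OF diff_in_root_lattice[OF L \<gamma>(1)]] add[OF L \<gamma>(1)] diff[OF L \<gamma>(1)] \<gamma>(2)
        by simp_all
      then show False by (rule long_root_no_string)
    qed
    then have "b = star a" using ab(1) by (auto simp: base_eq_iff)
    then show ?thesis using ab by blast
  qed
  then obtain \<tau> where \<tau>: "\<And>p. f (?L p) = ?L (\<tau> p)" by metis
  have L_inject: "?L p = ?L q \<Longrightarrow> p = q" for p q
    using wt_diff_eq[of p "star p" q "star q"] by auto
  have \<tau>_diff: "f (wt p - wt q) = wt (\<tau> p) - wt (\<tau> q)" for p q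
  proof -
    let ?D = "wt p - wt q"
    have D: "?D \<in> root_lattice" by (rule wt_diff_in_root_lattice)
    \<comment> \<open>Twice \<open>wt p - wt q\<close> is a difference of two long roots, where
      \<open>f\<close> is already known; the factor 2 is cancelled coordinatewise.\<close>
    have "f ?D + f ?D = f (?D + ?D)" by (rule add[OF D D, symmetric])
    also have "?D + ?D = ?L p - ?L q" by simp
    also have "f \<dots> = ?L (\<tau> p) - ?L (\<tau> q)"
      using diff[OF wt_diff_in_root_lattice wt_diff_in_root_lattice] \<tau> by metis
    also have "\<dots> = (wt (\<tau> p) - wt (\<tau> q)) + (wt (\<tau> p) - wt (\<tau> q))" by simp
    finally have *: "(f ?D + f ?D) $ i = (wt (\<tau> p) - wt (\<tau> q) + (wt (\<tau> p) - wt (\<tau> q))) $ i" for i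
      by simp
    have "f ?D $ i = (wt (\<tau> p) - wt (\<tau> q)) $ i" for i
      using *[of i] by simp
    then show ?thesis by (simp add: vec_eq_iff)
  qed
  have \<tau>_star: "\<tau> (star p) = star (\<tau> p)" for p
  proof -
    have "?L (\<tau> (star p)) = f (0 - ?L p)" using \<tau>[of "star p"] by simp
    also have "\<dots> = f 0 - f (?L p)"
      by (rule diff[OF zero_in_root_lattice wt_diff_in_root_lattice])
    also have "f 0 = 0" using add[OF zero_in_root_lattice zero_in_root_lattice] by simp
    finally have "?L (\<tau> (star p)) = ?L (star (\<tau> p))" using \<tau>[of p] by simp
    then show ?thesis by (rule L_inject)
  qed
  have inj_\<tau>: "\<tau> p = \<tau> q \<Longrightarrow> p = q" for p q
    using \<tau>[of p] \<tau>[of q] inj_onD[OF inj _ wt_diff_in_root_lattice wt_diff_in_root_lattice] L_inject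
    by metis
  show ?thesis
  proof (rule that[of \<tau>])
    show "base (\<tau> p) \<noteq> base (\<tau> q)" if "base p \<noteq> base q" for p q
      using that inj_\<tau>[of p q] inj_\<tau>[of p "star q"] \<tau>_star[of q] by (metis base_eq_iff)
  qed (use \<tau>_star \<tau>_diff in blast)+
qed

section \<open>Root vectors of the special symplectic Lie algebra\<close>

lemma munit_nth: "munit p q x $ a $ b = (if a = p \<and> b = q then x else 0)"
  by (simp add: munit_def axis_def)

lemma munit_mult:
  fixes x y :: "'a::ring_1"
  shows "munit p q x ** munit c d y = (if q = c then munit p d (x * y) else 0)"
proof -
  have "(\<Sum>k\<in>UNIV. munit p q x $ a $ k * munit c d y $ k $ b)
      = (\<Sum>k\<in>UNIV. if k = q then (if a = p \<and> q = c \<and> b = d then x * y else 0) else 0)" for a b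
    by (rule sum.cong) (auto simp: munit_nth)
  then show ?thesis
    by (simp add: matrix_matrix_mult_def vec_eq_iff munit_nth)
qed

lemma matrix_add_rdistrib: "(A + B) ** C = A ** C + B ** (C :: 'a::ring_1^'n::finite^'n)"
  by (simp add: matrix_matrix_mult_def vec_eq_iff sum.distrib[symmetric] distrib_right)

text \<open>One formula for root vectors of all nonzero roots \<open>wt p - wt q\<close>. The second
  entry is the one that the symplectic symmetry forces: its sign is minus for \<open>ssp_l\<close>,
  plus for \<open>ssp_m\<close> and \<open>ssp_n\<close>.\<close>

definition rvec :: "('a::ring_1 \<Rightarrow> 'a) \<Rightarrow> 'r::finite + 'r \<Rightarrow> 'r + 'r \<Rightarrow> 'a \<Rightarrow> ('a, 'r) dmat" where
  "rvec \<iota> p q x = munit p q x + munit (star q) (star p) (msign (1 + isg p + isg q) (\<iota> x))"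

lemma rvec_nth:
  "rvec \<iota> p q x $ a $ b = (if a = p \<and> b = q then x else 0) +
     (if a = star q \<and> b = star p then msign (1 + isg p + isg q) (\<iota> x) else 0)"
  by (simp add: rvec_def munit_nth)

text \<open>For a short root the two entries sit in different places, so the coefficient can be
  recovered. For \<open>q = star p\<close> they coincide and only \<open>x + \<iota> x\<close> is
  visible.\<close>

lemma rvec_nth_self: "base p \<noteq> base q \<Longrightarrow> rvec \<iota> p q x $ p $ q = x"
  by (cases "p = star q") (simp_all add: rvec_nth)

lemma rvec_inject:
  assumes "base p \<noteq> base q" "rvec \<iota> p q x = rvec \<iota> p q y"
  shows "x = y"
  by (metis assms rvec_nth_self)

lemma ssp_l_eq_rvec: "ssp_l \<iota> i j x = rvec \<iota> (Inl i) (Inl j) x"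
  and ssp_m_eq_rvec: "ssp_m \<iota> i j x = rvec \<iota> (Inl i) (Inr j) x"
  and ssp_n_eq_rvec: "ssp_n \<iota> i j x = rvec \<iota> (Inr i) (Inl j) x"
  by (auto simp: vec_eq_iff rvec_nth munit_nth msign_def ssp_l_def ssp_m_def ssp_n_def)

context char_0_torus_inv
begin

lemma msign_gr: "x \<in> gr \<alpha> \<Longrightarrow> msign n x \<in> gr \<alpha>"
  using minus_gr by (auto simp: msign_def)

lemma rvec_add: "rvec \<iota> p q (x + y) = rvec \<iota> p q x + rvec \<iota> p q y"
  by (auto simp: vec_eq_iff rvec_nth inv_add msign_add)

lemma rvec_smul: "rvec \<iota> p q (smul c x) = map_matrix (smul c) (rvec \<iota> p q x)"
  by (auto simp: vec_eq_iff rvec_nth inv_smul msign_def scale_right_distrib)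

lemma rvec_zero [simp]: "rvec \<iota> p q 0 = 0"
  by (auto simp: vec_eq_iff rvec_nth msign_def)

text \<open>Translates coefficients between the two ways of writing a root as a difference of
  weights.\<close>

lemma rvec_star: "rvec \<iota> p q x = rvec \<iota> (star q) (star p) (msign (1 + isg p + isg q) (\<iota> x))"
proof -
  have "msign (1 + isg (star q) + isg (star p)) (msign (1 + isg p + isg q) x) = x"
    unfolding msign_msign isg_star by (simp add: msign_def)
  then show ?thesis
    by (auto simp: vec_eq_iff rvec_nth inv_msign inv_inv)
qed

text \<open>With three different bases, only the product through \<open>q\<close> and its mirror
  image through \<open>star q\<close> survive. This is how the Lie bracket remembers the
  multiplication of the algebra.\<close>

lemma rvec_bracket:
  assumes "base p \<noteq> base q" "base q \<noteq> base t" "base p \<noteq> base t"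
  shows "rvec \<iota> p q x ** rvec \<iota> q t y - rvec \<iota> q t y ** rvec \<iota> p q x = rvec \<iota> p t (x * y)"
proof -
  have ne: "p \<noteq> q" "q \<noteq> t" "p \<noteq> t" "p \<noteq> star q" "q \<noteq> star t" "p \<noteq> star t" "q \<noteq> star p" "t \<noteq> star q"
    "t \<noteq> star p"
    using assms by auto
  have ne': "star p \<noteq> q" "star q \<noteq> t" "star p \<noteq> t" "star q \<noteq> p" "star t \<noteq> q" "star t \<noteq> p"
    "star p \<noteq> star t" "star q \<noteq> star t" "star p \<noteq> star q" "q \<noteq> p" "t \<noteq> q" "t \<noteq> p"
    using assms by auto
  show ?thesis
    using ne ne'
    by (simp add: rvec_def matrix_add_ldistrib matrix_add_rdistrib munit_mult inv_mult
        msign_mult_left msign_mult_right msign_msign)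
       (auto simp: vec_eq_iff munit_nth msign_def)
qed

text \<open>For a hermitian \<open>x\<close> the entry at a long root is \<open>x + x\<close>, which
  does not vanish in characteristic 0.\<close>

lemma rvec_nonzero:
  assumes "p \<noteq> q" "\<iota> x = x" "x \<noteq> 0"
  shows "rvec \<iota> p q x \<noteq> 0"
proof
  assume "rvec \<iota> p q x = 0"
  then have "rvec \<iota> p q x $ p $ q = 0" by simp
  then show False
    using assms two_torsion_free[of x]
    by (cases "q = star p") (auto simp: rvec_nth isg_star msign_def star_eq_iff split: if_splits)
qed

text \<open>Merges the three families into one indexed by pairs of weights. Pairs in the lower right
  block do not occur in \<open>ssp_comp\<close>; \<open>rvec_star\<close> moves them to the upper
  left.\<close>

lemma ssp_comp_nonzero_eq:
  assumes "\<beta> \<noteq> 0"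
  shows "ssp_comp smul gr \<iota> \<beta> \<alpha> =
    {0} \<union> \<Union>{rvec \<iota> p q ` gr \<alpha> | p q. p \<noteq> q \<and> \<beta> = wt p - wt q}" (is "?L = ?R")
proof
  have R: "rvec \<iota> p q x \<in> ?R" if "p \<noteq> q" "\<beta> = wt p - wt q" "x \<in> gr \<alpha>" for p q x
    using that by blast
  show "?L \<subseteq> ?R"
  proof
    fix M assume "M \<in> ?L"
    then consider "M = 0" | i j x where "x \<in> gr \<alpha>" "i \<noteq> j" "\<beta> = eps i - eps j" "M = ssp_l \<iota> i j x"
      | i j x where "x \<in> gr \<alpha>" "\<beta> = eps i + eps j" "M = ssp_m \<iota> i j x"
      | i j x where "x \<in> gr \<alpha>" "\<beta> = - (eps i + eps j)" "M = ssp_n \<iota> i j x"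
      using assms by (auto simp: ssp_comp_def)
    then show "M \<in> ?R"
    proof cases
      case 2
      then show ?thesis using R[of "Inl i" "Inl j" x] by (simp add: ssp_l_eq_rvec)
    next
      case 3
      then show ?thesis using R[of "Inl i" "Inr j" x] by (simp add: ssp_m_eq_rvec)
    next
      case 4
      then show ?thesis using R[of "Inr i" "Inl j" x] by (simp add: ssp_n_eq_rvec)
    qed simp
  qed
  have l: "ssp_l \<iota> i j x \<in> ?L" if "x \<in> gr \<alpha>" "i \<noteq> j" "\<beta> = eps i - eps j" for i j x
  proof -
    have "ssp_l \<iota> i j ` gr \<alpha> \<in> {ssp_l \<iota> i j ` gr \<alpha> | i j. i \<noteq> j \<and> \<beta> = eps i - eps j}"
      using that by blast
    from UnionI[OF this imageI[OF that(1)]] show ?thesis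
      unfolding ssp_comp_def if_not_P[OF assms] by (rule UnI2[THEN UnI1, THEN UnI1])
  qed
  have m: "ssp_m \<iota> i j x \<in> ?L" if "x \<in> gr \<alpha>" "\<beta> = eps i + eps j" for i j x
  proof -
    have "ssp_m \<iota> i j ` gr \<alpha> \<in> {ssp_m \<iota> i j ` gr \<alpha> | i j. \<beta> = eps i + eps j}"
      using that by blast
    from UnionI[OF this imageI[OF that(1)]] show ?thesis
      unfolding ssp_comp_def if_not_P[OF assms] by (rule UnI2[THEN UnI1])
  qed
  have n: "ssp_n \<iota> i j x \<in> ?L" if "x \<in> gr \<alpha>" "\<beta> = - (eps i + eps j)" for i j x
  proof -
    have "ssp_n \<iota> i j ` gr \<alpha> \<in> {ssp_n \<iota> i j ` gr \<alpha> | i j. \<beta> = - (eps i + eps j)}"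
      using that by blast
    from UnionI[OF this imageI[OF that(1)]] show ?thesis
      unfolding ssp_comp_def if_not_P[OF assms] by (rule UnI2)
  qed
  show "?R \<subseteq> ?L"
  proof
    fix M assume "M \<in> ?R"
    then consider "M = 0" | p q x where "p \<noteq> q" "\<beta> = wt p - wt q" "x \<in> gr \<alpha>" "M = rvec \<iota> p q x"
      by auto
    then show "M \<in> ?L"
    proof cases
      case 1
      then show ?thesis using assms by (simp add: ssp_comp_def)
    next
      case 2
      show ?thesis
      proof (cases p)
        case p: (Inl i)
        show ?thesis
        proof (cases q)
          case (Inl j)
          then show ?thesis using l[OF 2(3), of i j] 2 p by (simp add: ssp_l_eq_rvec)
        next
          case (Inr j)
          then show ?thesis using m[OF 2(3), of i j] 2 p by (simp add: ssp_m_eq_rvec)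
        qed
      next
        case p: (Inr i)
        show ?thesis
        proof (cases q)
          case (Inl j)
          then show ?thesis using n[OF 2(3), of i j] 2 p by (simp add: ssp_n_eq_rvec)
        next
          case q: (Inr j)
          have "M = rvec \<iota> (Inl j) (Inl i) (msign (1 + isg p + isg q) (\<iota> x))"
            using 2(4) rvec_star[of p q x] p q by simp
          moreover have "\<beta> = eps j - eps i" "j \<noteq> i" using 2 p q by auto
          ultimately show ?thesis
            using l[OF msign_gr[OF inv_in_gr[OF 2(3)]], of j i] by (simp add: ssp_l_eq_rvec)
        qed
      qed
    qed
  qed
qed

lemma ssp_comp_root:
  assumes "p \<noteq> q"
  shows "ssp_comp smul gr \<iota> (wt p - wt q) \<alpha> = rvec \<iota> p q ` gr \<alpha>"
proof -
  have nz: "wt p - wt q \<noteq> 0" using assms by (simp add: wt_inject)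
  have "rvec \<iota> p' q' ` gr \<alpha> \<subseteq> rvec \<iota> p q ` gr \<alpha>" if "wt p - wt q = wt p' - wt q'" for p' q'
    using wt_diff_eq[OF assms that] rvec_star[of p' q'] msign_gr inv_in_gr by auto
  moreover have "0 \<in> rvec \<iota> p q ` gr \<alpha>" using image_eqI[of 0 "rvec \<iota> p q" 0] by simp
  ultimately show ?thesis
    unfolding ssp_comp_nonzero_eq[OF nz] using assms by blast
qed

lemma ssp_comp_off_roots:
  "\<beta> \<noteq> 0 \<Longrightarrow> \<not> nonzero_root \<beta> \<Longrightarrow> ssp_comp smul gr \<iota> \<beta> \<alpha> = {0}"
  using ssp_comp_nonzero_eq[of \<beta> \<alpha>] by (auto simp: nonzero_root_def)

text \<open>The block conditions become one symmetry of entries, which can be checked without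
  splitting into blocks for root vectors and for maps applied entrywise.\<close>

lemma mem_ssp_carrier_iff:
  "M \<in> ssp_carrier smul \<iota> \<longleftrightarrow>
     (\<forall>p q. M $ star q $ star p = msign (1 + isg p + isg q) (\<iota> (M $ p $ q))) \<and>
     (\<Sum>i\<in>UNIV. M $ Inl i $ Inl i) \<in> sym_plus_comm smul \<iota>" (is "_ \<longleftrightarrow> ?S \<and> ?T")
proof
  assume "M \<in> ssp_carrier smul \<iota>"
  then obtain X Y Z where M: "M = block_matrix X Y Z (- conj_transpose \<iota> X)"
    and Y: "conj_transpose \<iota> Y = Y" and Z: "conj_transpose \<iota> Z = Z"
    and X: "trace X \<in> sym_plus_comm smul \<iota>"
    unfolding ssp_carrier_def by blast
  have "\<iota> (Y $ j $ i) = Y $ i $ j" "\<iota> (Z $ j $ i) = Z $ i $ j" for i j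
    using Y Z by (auto simp: conj_transpose_def transpose_def vec_eq_iff)
  then have "M $ star q $ star p = msign (1 + isg p + isg q) (\<iota> (M $ p $ q))" for p q
    by (cases p; cases q)
       (simp_all add: M block_matrix_def conj_transpose_def transpose_def msign_def inv_minus inv_inv)
  moreover have ?T using X by (simp add: M block_matrix_def trace_def)
  ultimately show "?S \<and> ?T" by blast
next
  assume "?S \<and> ?T"
  then have S: "M $ star q $ star p = msign (1 + isg p + isg q) (\<iota> (M $ p $ q))" and T: ?T for p q
    by blast+
  define X where "X = (\<chi> i j. M $ Inl i $ Inl j)"
  define Y where "Y = (\<chi> i j. M $ Inl i $ Inr j)"
  define Z where "Z = (\<chi> i j. M $ Inr i $ Inl j)"
  have "M = block_matrix X Y Z (- conj_transpose \<iota> X)"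
  proof -
    have "M $ p $ q = block_matrix X Y Z (- conj_transpose \<iota> X) $ p $ q" for p q
      using S[of "Inl j" "Inl i" for i j]
      by (cases p; cases q)
         (simp_all add: block_matrix_def X_def Y_def Z_def conj_transpose_def transpose_def msign_def)
    then show ?thesis by (simp add: vec_eq_iff)
  qed
  moreover have "\<iota> (M $ Inl i $ Inr j) = M $ Inl j $ Inr i"
    "\<iota> (M $ Inr i $ Inl j) = M $ Inr j $ Inl i" for i j
    using S[of "Inl i" "Inr j"] S[of "Inr i" "Inl j"] by (simp_all add: msign_def inv_inv)
  then have "conj_transpose \<iota> Y = Y" "conj_transpose \<iota> Z = Z"
    by (simp_all add: Y_def Z_def conj_transpose_def transpose_def vec_eq_iff)
  moreover have "trace X \<in> sym_plus_comm smul \<iota>"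
    using T by (simp add: X_def trace_def)
  ultimately show "M \<in> ssp_carrier smul \<iota>" unfolding ssp_carrier_def by blast
qed

lemma rvec_in_carrier:
  fixes p q :: "'r::finite + 'r"
  assumes "p \<noteq> q"
  shows "rvec \<iota> p q x \<in> ssp_carrier smul \<iota>"
  unfolding mem_ssp_carrier_iff
proof (intro conjI allI)
  fix a b :: "'r + 'r"
  let ?n = "1 + isg a + isg b"
  define s where "s = msign (1 + isg p + isg q) (\<iota> x)"
  \<comment> \<open>\<open>P\<close> and \<open>Q\<close> mark the two entries of the root vector.
    Both hold at once when the root is long, and then the entries add up.\<close>
  define P where "P \<longleftrightarrow> a = star q \<and> b = star p"
  define Q where "Q \<longleftrightarrow> a = p \<and> b = q"
  have P: "msign ?n (\<iota> s) = x" if P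
  proof -
    have ab: "a = star q" "b = star p" using that by (auto simp: P_def)
    show ?thesis
      unfolding s_def inv_msign inv_inv msign_msign ab isg_star by (simp add: msign_def)
  qed
  have Q: "msign ?n (\<iota> x) = s" if Q
    using that by (simp add: Q_def s_def)
  have "rvec \<iota> p q x $ star b $ star a = (if P then x else 0) + (if Q then s else 0)"
    unfolding rvec_nth star_inject star_eq_iff[of b] star_eq_iff[of a] P_def Q_def s_def
    by (simp add: conj_commute)
  moreover have "rvec \<iota> p q x $ a $ b = (if Q then x else 0) + (if P then s else 0)"
    unfolding rvec_nth P_def Q_def s_def ..
  moreover have "msign ?n (0 :: 'a) = 0" by (simp add: msign_def)
  ultimately show "rvec \<iota> p q x $ star b $ star a = msign ?n (\<iota> (rvec \<iota> p q x $ a $ b))"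
    using P Q by (cases P; cases Q) (simp_all add: inv_add msign_add)
next
  have "0 + 0 \<in> sym_plus_comm smul \<iota>"
    unfolding sym_plus_comm_def using span_zero by fastforce
  moreover have "(\<Sum>i\<in>UNIV. rvec \<iota> p q x $ Inl i $ Inl i) = 0"
    using assms by (intro sum.neutral) (auto simp: rvec_nth star_eq_iff)
  ultimately show "(\<Sum>i\<in>UNIV. rvec \<iota> p q x $ Inl i $ Inl i) \<in> sym_plus_comm smul \<iota>" by simp
qed

lemma zero_in_ssp_carrier: "0 \<in> ssp_carrier smul \<iota>"
  using rvec_in_carrier[of "Inl undefined" "Inr undefined" 0] by simp

text \<open>The unit is hermitian of degree 0. In particular the zero homomorphism is
  admissible.\<close>

lemma root_space_nonzero:
  assumes "nonzero_root \<beta>"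
  shows "ssp_comp smul gr \<iota> \<beta> 0 \<noteq> {0}"
proof -
  obtain p q where "p \<noteq> q" "\<beta> = wt p - wt q" using assms by (auto simp: nonzero_root_def)
  then show ?thesis
    using ssp_comp_root[of p q 0] rvec_nonzero[of p q 1] one_gr by auto
qed

lemma root_space_subset_carrier:
  "\<beta> \<noteq> 0 \<Longrightarrow> ssp_comp smul gr \<iota> \<beta> \<alpha> \<subseteq> ssp_carrier smul \<iota>"
  using ssp_comp_nonzero_eq[of \<beta> \<alpha>] zero_in_ssp_carrier rvec_in_carrier by auto

end

section \<open>From isograded isomorphisms to bi-isomorphisms\<close>

locale two_tori = A: char_0_torus_inv smul gr \<iota> + B: char_0_torus_inv smul' gr' \<iota>'
  for smul :: "'f::field_char_0 \<Rightarrow> 'a::ring_1 \<Rightarrow> 'a"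
    and gr :: "'l::ab_group_add \<Rightarrow> 'a set"
    and \<iota> :: "'a \<Rightarrow> 'a"
    and smul' :: "'f \<Rightarrow> 'b::ring_1 \<Rightarrow> 'b"
    and gr' :: "'k::ab_group_add \<Rightarrow> 'b set"
    and \<iota>' :: "'b \<Rightarrow> 'b"

locale isograded_iso = two_tori smul gr \<iota> smul' gr' \<iota>'
  for smul :: "'f::field_char_0 \<Rightarrow> 'a::ring_1 \<Rightarrow> 'a"
    and gr :: "'l::ab_group_add \<Rightarrow> 'a set"
    and \<iota> :: "'a \<Rightarrow> 'a"
    and smul' :: "'f \<Rightarrow> 'b::ring_1 \<Rightarrow> 'b"
    and gr' :: "'k::ab_group_add \<Rightarrow> 'b set"
    and \<iota>' :: "'b \<Rightarrow> 'b" +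
  fixes \<eta> :: "'a \<Rightarrow> 'b" and \<eta>gr :: "'l \<Rightarrow> 'k"
  assumes bij: "bij \<eta>"
    and linear: "Vector_Spaces.linear smul smul' \<eta>"
    and mult: "\<eta> (x * y) = \<eta> x * \<eta> y"
    and inv: "\<eta> (\<iota> x) = \<iota>' (\<eta> x)"
    and gr_iso: "group_iso_on UNIV UNIV \<eta>gr"
    and gr_image: "\<eta> ` gr \<alpha> = gr' (\<eta>gr \<alpha>)"
begin

lemma add: "\<eta> (x + y) = \<eta> x + \<eta> y"
  using linear by (simp add: Vector_Spaces.linear_iff)

lemma smul: "\<eta> (smul c x) = smul' c (\<eta> x)"
  using linear by (simp add: Vector_Spaces.linear_iff)

lemma zero [simp]: "\<eta> 0 = 0"
  using add[of 0 0] by simp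

lemma minus: "\<eta> (- x) = - \<eta> x"
  using add[of x "- x"] by (simp add: eq_neg_iff_add_eq_0 add.commute)

lemma diff: "\<eta> (x - y) = \<eta> x - \<eta> y"
  using add[of x "- y"] by (simp add: minus)

lemma sum: "\<eta> (sum f S) = (\<Sum>i\<in>S. \<eta> (f i))"
  by (induction S rule: infinite_finite_induct) (simp_all add: add)

lemma msign: "\<eta> (msign n x) = msign n (\<eta> x)"
  by (simp add: msign_def minus)

lemma eq_iff: "\<eta> x = \<eta> y \<longleftrightarrow> x = y"
  using bij by (metis bij_pointE)

lemma obtain_preimage: obtains x where "y = \<eta> x"
  using bij by (metis bij_pointE)

text \<open>Needed for the trace conditions in the carrier and in the components at root 0.\<close>

lemma sym_plus_comm_image: "\<eta> ` sym_plus_comm smul \<iota> = sym_plus_comm smul' \<iota>'"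
proof -
  let ?C = "{x * y - y * x | x y. True}" and ?C' = "{x * y - y * x | x y :: 'b. True}"
  have "\<eta> ` ?C = ?C'"
  proof
    show "\<eta> ` ?C \<subseteq> ?C'" by (auto simp: diff mult) blast
    show "?C' \<subseteq> \<eta> ` ?C"
    proof
      fix z assume "z \<in> ?C'"
      then obtain x' y' where "z = x' * y' - y' * x'" by blast
      moreover obtain x y where "x' = \<eta> x" "y' = \<eta> y" by (metis obtain_preimage)
      ultimately have "z = \<eta> (x * y - y * x)" by (simp add: diff mult)
      then show "z \<in> \<eta> ` ?C" by blast
    qed
  qed
  moreover have "B.span (\<eta> ` ?C) = \<eta> ` A.span ?C"
    by (rule module_hom.span_image) (use linear in \<open>simp add: Vector_Spaces.linear_iff_module_hom\<close>)
  ultimately have span: "\<eta> ` A.span ?C = B.span ?C'" by simp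
  show ?thesis
  proof
    show "\<eta> ` sym_plus_comm smul \<iota> \<subseteq> sym_plus_comm smul' \<iota>'"
    proof
      fix z assume "z \<in> \<eta> ` sym_plus_comm smul \<iota>"
      then obtain a b where ab: "z = \<eta> (a + b)" "\<iota> a = a" "b \<in> A.span ?C"
        unfolding sym_plus_comm_def by blast
      then have "\<eta> b \<in> B.span ?C'" "\<iota>' (\<eta> a) = \<eta> a" using span inv[of a] by auto
      then show "z \<in> sym_plus_comm smul' \<iota>'"
        unfolding sym_plus_comm_def using ab(1) add by blast
    qed
    show "sym_plus_comm smul' \<iota>' \<subseteq> \<eta> ` sym_plus_comm smul \<iota>"
    proof
      fix z assume "z \<in> sym_plus_comm smul' \<iota>'"
      then obtain a' b' where ab': "z = a' + b'" "\<iota>' a' = a'" "b' \<in> B.span ?C'"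
        unfolding sym_plus_comm_def by blast
      obtain a where a: "a' = \<eta> a" by (rule obtain_preimage)
      obtain b where b: "b' = \<eta> b" "b \<in> A.span ?C" using ab'(3) span by blast
      have "\<iota> a = a" using ab'(2) inv[of a] eq_iff by (simp add: a)
      then have "a + b \<in> sym_plus_comm smul \<iota>" unfolding sym_plus_comm_def using b(2) by blast
      moreover have "z = \<eta> (a + b)" using ab'(1) a b(1) by (simp add: add)
      ultimately show "z \<in> \<eta> ` sym_plus_comm smul \<iota>" by blast
    qed
  qed
qed

lemma mem_sym_plus_comm: "\<eta> x \<in> sym_plus_comm smul' \<iota>' \<longleftrightarrow> x \<in> sym_plus_comm smul \<iota>"
  using sym_plus_comm_image eq_iff by (metis image_iff)

lemma map_matrix_rvec: "map_matrix \<eta> (rvec \<iota> p q x) = rvec \<iota>' p q (\<eta> x)"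
  by (auto simp: vec_eq_iff rvec_nth add msign inv)

lemma ssp_zero_comp_image:
  "map_matrix \<eta> ` ssp_zero_comp smul gr \<iota> \<alpha> = ssp_zero_comp smul' gr' \<iota>' (\<eta>gr \<alpha>)"
proof -
  let ?d = "\<lambda>x. \<Sum>i\<in>UNIV. munit (Inl i) (Inl i) (x i) - munit (Inr i) (Inr i) (\<iota> (x i))"
  let ?d' = "\<lambda>x. \<Sum>i\<in>UNIV. munit (Inl i) (Inl i) (x i) - munit (Inr i) (Inr i) (\<iota>' (x i))"
  have d: "map_matrix \<eta> (?d x) = ?d' (\<lambda>i. \<eta> (x i))" for x :: "'c::finite \<Rightarrow> 'a"
    by (auto simp: vec_eq_iff sum_component sum diff munit_nth inv intro!: sum.cong)
  have tr: "(\<Sum>i\<in>UNIV. \<eta> (x i)) \<in> sym_plus_comm smul' \<iota>' \<longleftrightarrow> (\<Sum>i\<in>UNIV. x i) \<in> sym_plus_comm smul \<iota>"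
    for x :: "'c \<Rightarrow> 'a"
    using mem_sym_plus_comm[of "\<Sum>i\<in>UNIV. x i"] by (simp add: sum)
  show ?thesis
  proof
    show "map_matrix \<eta> ` ssp_zero_comp smul gr \<iota> \<alpha> \<subseteq> (ssp_zero_comp smul' gr' \<iota>' (\<eta>gr \<alpha>) :: ('b, 'c) dmat set)"
    proof
      fix M :: "('b, 'c) dmat" assume "M \<in> map_matrix \<eta> ` ssp_zero_comp smul gr \<iota> \<alpha>"
      then obtain x where x: "M = map_matrix \<eta> (?d x)" "\<And>i. x i \<in> gr \<alpha>"
        "(\<Sum>i\<in>UNIV. x i) \<in> sym_plus_comm smul \<iota>"
        unfolding ssp_zero_comp_def by blast
      have "M = ?d' (\<lambda>i. \<eta> (x i))" unfolding x(1) by (rule d)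
      moreover have "\<eta> (x i) \<in> gr' (\<eta>gr \<alpha>)" for i using gr_image x(2) by blast
      moreover have "(\<Sum>i\<in>UNIV. \<eta> (x i)) \<in> sym_plus_comm smul' \<iota>'" using tr x(3) by blast
      ultimately show "M \<in> ssp_zero_comp smul' gr' \<iota>' (\<eta>gr \<alpha>)"
        unfolding ssp_zero_comp_def by (auto intro!: exI[of _ "\<lambda>i. \<eta> (x i)"])
    qed
    show "(ssp_zero_comp smul' gr' \<iota>' (\<eta>gr \<alpha>) :: ('b, 'c) dmat set) \<subseteq> map_matrix \<eta> ` ssp_zero_comp smul gr \<iota> \<alpha>"
    proof
      fix M :: "('b, 'c) dmat" assume "M \<in> ssp_zero_comp smul' gr' \<iota>' (\<eta>gr \<alpha>)"
      then obtain x' where x': "M = ?d' x'" "\<And>i. x' i \<in> gr' (\<eta>gr \<alpha>)"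
        "(\<Sum>i\<in>UNIV. x' i) \<in> sym_plus_comm smul' \<iota>'"
        unfolding ssp_zero_comp_def by blast
      have "\<forall>i. \<exists>x. x \<in> gr \<alpha> \<and> x' i = \<eta> x" using x'(2) gr_image by blast
      then obtain x where x: "\<And>i. x i \<in> gr \<alpha>" "\<And>i. x' i = \<eta> (x i)" by metis
      have "x' = (\<lambda>i. \<eta> (x i))" using x(2) by blast
      then have M: "M = map_matrix \<eta> (?d x)" and "(\<Sum>i\<in>UNIV. x i) \<in> sym_plus_comm smul \<iota>"
        using x'(1,3) d[of x] tr[of x] by simp_all
      then have "?d x \<in> ssp_zero_comp smul gr \<iota> \<alpha>"
        unfolding ssp_zero_comp_def using x(1) by (auto intro!: exI[of _ x])
      then show "M \<in> map_matrix \<eta> ` ssp_zero_comp smul gr \<iota> \<alpha>"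
        unfolding M by (rule imageI)
    qed
  qed
qed

lemma ssp_comp_image:
  "map_matrix \<eta> ` ssp_comp smul gr \<iota> \<beta> \<alpha> = ssp_comp smul' gr' \<iota>' \<beta> (\<eta>gr \<alpha>)"
proof (cases "\<beta> = 0")
  case True
  then show ?thesis by (simp add: ssp_comp_def ssp_zero_comp_image)
next
  case False
  show ?thesis
  proof (cases "nonzero_root \<beta>")
    case True
    then obtain p q where pq: "p \<noteq> q" "\<beta> = wt p - wt q" by (auto simp: nonzero_root_def)
    then show ?thesis
      by (simp add: A.ssp_comp_root B.ssp_comp_root image_image map_matrix_rvec flip: gr_image)
  next
    case nr: False
    have "map_matrix \<eta> 0 = 0" by (simp add: vec_eq_iff)
    then show ?thesis
      using A.ssp_comp_off_roots[OF False nr] B.ssp_comp_off_roots[OF False nr] by simp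
  qed
qed

lemma map_matrix_mem_carrier:
  "map_matrix \<eta> M \<in> ssp_carrier smul' \<iota>' \<longleftrightarrow> M \<in> ssp_carrier smul \<iota>"
proof -
  have "\<eta> (M $ star q $ star p) = msign (1 + isg p + isg q) (\<iota>' (\<eta> (M $ p $ q))) \<longleftrightarrow>
      M $ star q $ star p = msign (1 + isg p + isg q) (\<iota> (M $ p $ q))" for p q
    by (simp add: inv[symmetric] msign[symmetric] eq_iff)
  then show ?thesis
    by (simp add: A.mem_ssp_carrier_iff B.mem_ssp_carrier_iff sum[symmetric] mem_sym_plus_comm)
qed

text \<open>Applying \<open>\<eta>\<close> to each entry leaves positions, and hence roots, in
  place; so the identity acts on the root lattice and \<open>\<eta>gr\<close> on degrees.\<close>

lemma ssp_bi_isomorphic: "bi_isomorphic (ssp TYPE('r::finite) smul gr \<iota>) (ssp TYPE('r) smul' gr' \<iota>')"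
  unfolding bi_isomorphic_def
proof (intro exI conjI)
  let ?\<phi> = "map_matrix \<eta> :: ('a, 'r) dmat \<Rightarrow> ('b, 'r) dmat"
  have "inj ?\<phi>" by (rule injI) (simp add: vec_eq_iff eq_iff)
  moreover have "?\<phi> ` ssp_carrier smul \<iota> = ssp_carrier smul' \<iota>'"
  proof
    show "?\<phi> ` ssp_carrier smul \<iota> \<subseteq> ssp_carrier smul' \<iota>'"
      using map_matrix_mem_carrier by blast
    show "ssp_carrier smul' \<iota>' \<subseteq> ?\<phi> ` ssp_carrier smul \<iota>"
    proof
      fix N :: "('b, 'r) dmat" assume N: "N \<in> ssp_carrier smul' \<iota>'"
      have "N = ?\<phi> (map_matrix (the_inv \<eta>) N)"
        using bij by (simp add: vec_eq_iff f_the_inv_into_f_bij_betw)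
      then show "N \<in> ?\<phi> ` ssp_carrier smul \<iota>"
        using N map_matrix_mem_carrier by (metis imageI)
    qed
  qed
  moreover have "?\<phi> (M ** N) = ?\<phi> M ** ?\<phi> N" for M N
    by (simp add: vec_eq_iff matrix_matrix_mult_def sum mult)
  moreover have "?\<phi> (M - N) = ?\<phi> M - ?\<phi> N" for M N
    by (simp add: vec_eq_iff diff)
  ultimately show "lie_iso (ssp TYPE('r) smul gr \<iota>) (ssp TYPE('r) smul' gr' \<iota>') ?\<phi>"
    by (auto simp: lie_iso_def ssp_def bij_betw_def vec_eq_iff add smul intro: inj_on_subset)
  show "group_iso_on root_lattice root_lattice id"
    by (simp add: group_iso_on_def group_hom_on_def)
  show "group_iso_on UNIV UNIV \<eta>gr" by (rule gr_iso)
  show "\<forall>\<beta>\<in>root_lattice. \<forall>\<alpha>. ?\<phi> ` lie_comp (ssp TYPE('r) smul gr \<iota>) \<beta> \<alpha> =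
      lie_comp (ssp TYPE('r) smul' gr' \<iota>') (id \<beta>) (\<eta>gr \<alpha>)"
    by (simp add: ssp_def ssp_comp_image)
qed

end

section \<open>From isotopies to isograded isomorphisms\<close>

text \<open>An isotopy in unfolded form: the isotope has the same underlying Lie algebra, so
  \<open>s\<close> enters only through admissibility and the degree shift in
  \<open>comp_image\<close>.\<close>

locale ssp_isotopy = two_tori smul gr \<iota> smul' gr' \<iota>'
  for smul :: "'f::field_char_0 \<Rightarrow> 'a::ring_1 \<Rightarrow> 'a"
    and gr :: "'l::ab_group_add \<Rightarrow> 'a set"
    and \<iota> :: "'a \<Rightarrow> 'a"
    and smul' :: "'f \<Rightarrow> 'b::ring_1 \<Rightarrow> 'b"
    and gr' :: "'k::ab_group_add \<Rightarrow> 'b set"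
    and \<iota>' :: "'b \<Rightarrow> 'b" +
  fixes \<phi> :: "('a, 'r::finite) dmat \<Rightarrow> ('b, 'r) dmat"
    and \<phi>r :: "int^'r \<Rightarrow> int^'r" and \<phi>e :: "'l \<Rightarrow> 'k" and s :: "int^'r \<Rightarrow> 'l"
  assumes iso: "lie_iso (ssp TYPE('r) smul gr \<iota>) (ssp TYPE('r) smul' gr' \<iota>') \<phi>"
    and \<phi>r: "group_iso_on root_lattice root_lattice \<phi>r"
    and \<phi>e: "group_iso_on UNIV UNIV \<phi>e"
    and admissible: "nonzero_root \<beta> \<Longrightarrow> ssp_comp smul gr \<iota> \<beta> (s \<beta>) \<noteq> {0}"
    and comp_image: "\<beta> \<in> root_lattice \<Longrightarrow>
      \<phi> ` ssp_comp smul gr \<iota> \<beta> (\<alpha> + s \<beta>) = ssp_comp smul' gr' \<iota>' (\<phi>r \<beta>) (\<phi>e \<alpha>)"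
begin

lemma
  assumes "x \<in> ssp_carrier smul \<iota>" "y \<in> ssp_carrier smul \<iota>"
  shows \<phi>_add: "\<phi> (x + y) = \<phi> x + \<phi> y"
    and \<phi>_bracket: "\<phi> (x ** y - y ** x) = \<phi> x ** \<phi> y - \<phi> y ** \<phi> x"
    and \<phi>_eq_iff: "\<phi> x = \<phi> y \<longleftrightarrow> x = y"
    and \<phi>_smul: "\<phi> (map_matrix (smul c) x) = map_matrix (smul' c) (\<phi> x)"
  using iso assms by (auto simp: lie_iso_def ssp_def bij_betw_def inj_on_eq_iff)

lemma \<phi>_zero [simp]: "\<phi> 0 = 0"
  using \<phi>_add[OF A.zero_in_ssp_carrier A.zero_in_ssp_carrier] by simp

lemma \<phi>e_add: "\<phi>e (x + y) = \<phi>e x + \<phi>e y"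
  using \<phi>e by (simp add: group_iso_on_def group_hom_on_def)

text \<open>Away from 0, the roots are exactly the indices with some nonzero component, and
  \<open>\<phi>\<close> preserves this. Admissibility supplies a nonzero component in one direction,
  the unit of the target algebra in the other.\<close>

lemma nonzero_root_\<phi>r:
  assumes "\<beta> \<in> root_lattice"
  shows "nonzero_root (\<phi>r \<beta>) \<longleftrightarrow> nonzero_root \<beta>"
proof -
  have "\<phi>r (0 + 0) = \<phi>r 0 + \<phi>r 0"
    using \<phi>r zero_in_root_lattice unfolding group_iso_on_def group_hom_on_def by blast
  then have zero: "\<phi>r 0 = 0" by simp
  then have \<phi>r_eq_0: "\<phi>r \<beta> = 0 \<longleftrightarrow> \<beta> = 0"
    using \<phi>r assms zero_in_root_lattice unfolding group_iso_on_def bij_betw_def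
    by (metis inj_on_eq_iff)
  show ?thesis
  proof
    assume r: "nonzero_root \<beta>"
    then have nz: "\<beta> \<noteq> 0" by (simp add: nonzero_root_iff)
    have "0 \<in> ssp_comp smul gr \<iota> \<beta> (s \<beta>)" unfolding A.ssp_comp_nonzero_eq[OF nz] by blast
    then obtain M where M: "M \<in> ssp_comp smul gr \<iota> \<beta> (s \<beta>)" "M \<noteq> 0"
      using admissible[OF r] by blast
    then have "\<phi> M \<noteq> 0"
      using \<phi>_eq_iff[of M 0] A.root_space_subset_carrier[OF nz] A.zero_in_ssp_carrier by auto
    \<comment> \<open>Degree \<open>s \<beta>\<close> of the original algebra is degree 0 of the
      isotope.\<close>
    moreover have "\<phi> M \<in> ssp_comp smul' gr' \<iota>' (\<phi>r \<beta>) (\<phi>e 0)"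
      using comp_image[OF assms, of 0] M(1) by auto
    ultimately show "nonzero_root (\<phi>r \<beta>)"
      using B.ssp_comp_off_roots[of "\<phi>r \<beta>" "\<phi>e 0"] \<phi>r_eq_0 nz by blast
  next
    assume r: "nonzero_root (\<phi>r \<beta>)"
    then have nz: "\<beta> \<noteq> 0" using \<phi>r_eq_0 by (auto simp: nonzero_root_iff)
    have "surj \<phi>e" using \<phi>e by (simp add: group_iso_on_def bij_betw_def)
    then obtain \<alpha> where \<alpha>: "\<phi>e \<alpha> = 0" by (metis surj_def)
    show "nonzero_root \<beta>"
    proof (rule ccontr)
      assume "\<not> nonzero_root \<beta>"
      then have "ssp_comp smul' gr' \<iota>' (\<phi>r \<beta>) 0 = {0}"
        using comp_image[OF assms, of \<alpha>] A.ssp_comp_off_roots[OF nz] \<alpha> by simp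
      then show False using B.root_space_nonzero[OF r] by simp
    qed
  qed
qed

end

text \<open>Here \<open>\<tau>\<close> is the signed permutation through which \<open>\<phi>r\<close> acts on weights,
  and \<open>f p q\<close> is the map between coordinate algebras that \<open>\<phi>\<close> induces on the root spaces of
  \<open>wt p - wt q\<close>.\<close>

locale ssp_isotopy_weights = ssp_isotopy smul gr \<iota> smul' gr' \<iota>' \<phi> \<phi>r \<phi>e s
  for smul :: "'f::field_char_0 \<Rightarrow> 'a::ring_1 \<Rightarrow> 'a"
    and gr :: "'l::ab_group_add \<Rightarrow> 'a set"
    and \<iota> :: "'a \<Rightarrow> 'a"
    and smul' :: "'f \<Rightarrow> 'b::ring_1 \<Rightarrow> 'b"
    and gr' :: "'k::ab_group_add \<Rightarrow> 'b set"
    and \<iota>' :: "'b \<Rightarrow> 'b"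
    and \<phi> :: "('a, 'r::finite) dmat \<Rightarrow> ('b, 'r) dmat"
    and \<phi>r :: "int^'r \<Rightarrow> int^'r" and \<phi>e :: "'l \<Rightarrow> 'k" and s :: "int^'r \<Rightarrow> 'l" +
  fixes \<tau> :: "'r + 'r \<Rightarrow> 'r + 'r"
  assumes \<tau>_star: "\<tau> (star p) = star (\<tau> p)"
    and \<tau>_base: "base p \<noteq> base q \<Longrightarrow> base (\<tau> p) \<noteq> base (\<tau> q)"
    and \<tau>_wt: "\<phi>r (wt p - wt q) = wt (\<tau> p) - wt (\<tau> q)"
begin

definition f :: "'r + 'r \<Rightarrow> 'r + 'r \<Rightarrow> 'a \<Rightarrow> 'b" where
  "f p q x = \<phi> (rvec \<iota> p q x) $ \<tau> p $ \<tau> q"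

abbreviation deg :: "'r + 'r \<Rightarrow> 'r + 'r \<Rightarrow> 'l" where
  "deg p q \<equiv> s (wt p - wt q)"

lemma \<phi>_rvec_image:
  assumes "base p \<noteq> base q"
  shows "\<phi> ` rvec \<iota> p q ` gr \<alpha> = rvec \<iota>' (\<tau> p) (\<tau> q) ` gr' (\<phi>e (\<alpha> - deg p q))"
proof -
  have "p \<noteq> q" "\<tau> p \<noteq> \<tau> q" using assms \<tau>_base[OF assms] by auto
  then show ?thesis
    using comp_image[OF wt_diff_in_root_lattice[of p q], of "\<alpha> - deg p q"]
    by (simp add: A.ssp_comp_root B.ssp_comp_root \<tau>_wt)
qed

lemma rvec_carrier: "base p \<noteq> base q \<Longrightarrow> rvec \<iota> p q x \<in> ssp_carrier smul \<iota>"
  by (rule A.rvec_in_carrier) auto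

lemma f_add: "base p \<noteq> base q \<Longrightarrow> f p q (x + y) = f p q x + f p q y"
  by (simp add: f_def A.rvec_add \<phi>_add rvec_carrier)

lemma f_smul: "base p \<noteq> base q \<Longrightarrow> f p q (smul c x) = smul' c (f p q x)"
  by (simp add: f_def A.rvec_smul \<phi>_smul[OF rvec_carrier rvec_carrier])

text \<open>The grading determines the shape of the image for homogeneous coefficients, and
  additivity extends it to all.\<close>

lemma \<phi>_rvec:
  assumes "base p \<noteq> base q"
  shows "\<phi> (rvec \<iota> p q x) = rvec \<iota>' (\<tau> p) (\<tau> q) (f p q x)"
proof (induction x rule: A.homogeneous_induct)
  case (1 \<alpha> x)
  then obtain y where "\<phi> (rvec \<iota> p q x) = rvec \<iota>' (\<tau> p) (\<tau> q) y"
    using \<phi>_rvec_image[OF assms, of \<alpha>] by blast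
  then show ?case by (simp add: f_def rvec_nth_self \<tau>_base[OF assms])
next
  case (2 x y)
  then show ?case
    by (simp add: f_add[OF assms] A.rvec_add B.rvec_add \<phi>_add rvec_carrier[OF assms])
qed

lemma f_gr:
  assumes "base p \<noteq> base q"
  shows "f p q ` gr \<alpha> = gr' (\<phi>e (\<alpha> - deg p q))"
proof -
  have "rvec \<iota>' (\<tau> p) (\<tau> q) ` f p q ` gr \<alpha> = rvec \<iota>' (\<tau> p) (\<tau> q) ` gr' (\<phi>e (\<alpha> - deg p q))"
    using \<phi>_rvec_image[OF assms] by (simp add: image_image \<phi>_rvec[OF assms])
  moreover have "inj (rvec \<iota>' (\<tau> p) (\<tau> q))"
    using rvec_inject[OF \<tau>_base[OF assms]] by (auto intro: injI)
  ultimately show ?thesis by (simp add: inj_image_eq_iff)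
qed

lemma f_inject:
  assumes "base p \<noteq> base q" "f p q x = f p q y"
  shows "x = y"
proof -
  have "rvec \<iota> p q x = rvec \<iota> p q y"
    using \<phi>_rvec[OF assms(1), of x] \<phi>_rvec[OF assms(1), of y] assms(2)
      \<phi>_eq_iff[OF rvec_carrier[OF assms(1)] rvec_carrier[OF assms(1)]] by metis
  then show ?thesis by (rule rvec_inject[OF assms(1)])
qed

lemma f_mult:
  assumes "base p \<noteq> base q" "base q \<noteq> base t" "base p \<noteq> base t"
  shows "f p t (x * y) = f p q x * f q t y"
proof -
  let ?X = "rvec \<iota> p q x" and ?Y = "rvec \<iota> q t y"
  have "rvec \<iota>' (\<tau> p) (\<tau> t) (f p t (x * y)) = \<phi> (?X ** ?Y - ?Y ** ?X)"
    by (simp add: A.rvec_bracket[OF assms] \<phi>_rvec[OF assms(3)])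
  also have "\<dots> = \<phi> ?X ** \<phi> ?Y - \<phi> ?Y ** \<phi> ?X"
    by (rule \<phi>_bracket[OF rvec_carrier[OF assms(1)] rvec_carrier[OF assms(2)]])
  also have "\<dots> = rvec \<iota>' (\<tau> p) (\<tau> t) (f p q x * f q t y)"
    by (simp add: \<phi>_rvec assms B.rvec_bracket \<tau>_base)
  finally show ?thesis by (rule rvec_inject[OF \<tau>_base[OF assms(3)]])
qed

text \<open>Its parity records whether \<open>\<tau>\<close> exchanges the two blocks at
  \<open>p\<close>, that is, changes the sign of the weight.\<close>

definition twist :: "'r + 'r \<Rightarrow> int" where
  "twist p = isg p + isg (\<tau> p)"

text \<open>Rewrites one root vector by \<open>rvec_star\<close> before and after applying
  \<open>\<phi>\<close>; the sign is the discrepancy between the two rewritings.\<close>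

lemma f_star:
  assumes "base p \<noteq> base q"
  shows "f (star q) (star p) (\<iota> x) = msign (twist p + twist q) (\<iota>' (f p q x))"
proof -
  let ?n = "1 + isg p + isg q" and ?n' = "1 + isg (\<tau> p) + isg (\<tau> q)"
  have sb: "base (star q) \<noteq> base (star p)" using assms by simp
  have f_minus: "f (star q) (star p) (- y) = - f (star q) (star p) y" for y
    using f_add[OF sb, of y "- y"] f_add[OF sb, of 0 0]
    by (simp add: eq_neg_iff_add_eq_0 add.commute)
  have "rvec \<iota>' (star (\<tau> q)) (star (\<tau> p)) (msign ?n' (\<iota>' (f p q x))) = \<phi> (rvec \<iota> p q x)"
    using B.rvec_star[of "\<tau> p" "\<tau> q" "f p q x"] \<phi>_rvec[OF assms, of x] by simp
  also have "\<dots> = rvec \<iota>' (star (\<tau> q)) (star (\<tau> p)) (f (star q) (star p) (msign ?n (\<iota> x)))"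
    using A.rvec_star[of p q x] \<phi>_rvec[OF sb, of "msign ?n (\<iota> x)"] by (simp add: \<tau>_star)
  finally have "msign ?n' (\<iota>' (f p q x)) = f (star q) (star p) (msign ?n (\<iota> x))"
    by (rule rvec_inject[rotated]) (use \<tau>_base[OF sb] in \<open>simp add: \<tau>_star\<close>)
  also have "\<dots> = msign ?n (f (star q) (star p) (\<iota> x))"
    by (simp add: msign_def f_minus)
  finally have "msign ?n (msign ?n' (\<iota>' (f p q x))) = msign ?n (msign ?n (f (star q) (star p) (\<iota> x)))"
    by (rule arg_cong)
  then have "msign (?n + ?n') (\<iota>' (f p q x)) = msign (?n + ?n) (f (star q) (star p) (\<iota> x))"
    by (simp only: msign_msign)
  then have "f (star q) (star p) (\<iota> x) = msign (?n + ?n') (\<iota>' (f p q x))"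
    by (simp add: msign_def)
  also have "\<dots> = msign (twist p + twist q) (\<iota>' (f p q x))"
    by (rule msign_cong) (simp add: twist_def)
  finally show ?thesis .
qed

lemma twist_star: "even (twist (star p) - twist p)"
  by (simp add: twist_def \<tau>_star isg_star)

lemma f_one:
  assumes "base p \<noteq> base q"
  shows "f p q 1 \<in> gr' (\<phi>e (- deg p q))" "f p q 1 \<noteq> 0"
proof -
  show "f p q 1 \<in> gr' (\<phi>e (- deg p q))" using f_gr[OF assms, of 0] A.one_gr by auto
  have "f p q 0 = 0" using f_add[OF assms, of 0 0] by simp
  then show "f p q 1 \<noteq> 0" using f_inject[OF assms, of 1 0] by auto
qed

text \<open>Three indices suffice to recover the coordinate algebra. The comparison of the two involutions
  is only up to the unit \<open>h\<close>, whose hermitian symmetry comes from comparing the root spaces of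
  \<open>\<epsilon>\<^sub>2 + \<epsilon>\<^sub>3\<close> computed along two paths.\<close>

lemma twisted_isomorphism:
  assumes card: "CARD('r) \<ge> 3"
  obtains \<eta> h \<omega> where "bij \<eta>" "Vector_Spaces.linear smul smul' \<eta>" "\<And>x y. \<eta> (x * y) = \<eta> x * \<eta> y"
    "\<eta> 1 = 1" "\<And>\<alpha>. \<eta> ` gr \<alpha> = gr' (\<phi>e \<alpha>)" "h \<in> gr' \<omega>" "h \<noteq> 0" "\<iota>' h = h"
    "\<And>x. \<eta> (\<iota> x) = h * \<iota>' (\<eta> x) * B.unit_inv h"
proof -
  obtain i1 i2 i3 :: 'r where i: "i1 \<noteq> i2" "i2 \<noteq> i3" "i1 \<noteq> i3"
    using card by (auto simp: numeral_3_eq_3 card_le_Suc_iff)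
  let ?a1 = "Inl i1" and ?a2 = "Inl i2" and ?a3 = "Inl i3"
  let ?b1 = "Inr i1" and ?b2 = "Inr i2" and ?b3 = "Inr i3"
  \<comment> \<open>These are homogeneous units, and dividing by them turns the various
    \<open>f p q\<close> into a single algebra map.\<close>
  define c where "c p q = f p q 1" for p q
  have f_c: "f p t x = f p q x * c q t" "f p t x = c p q * f q t x"
    if "base p \<noteq> base q" "base q \<noteq> base t" "base p \<noteq> base t" for p q t x
    using f_mult[OF that, of x 1] f_mult[OF that, of 1 x] by (simp_all add: c_def)
  have c_c: "c p t = c p q * c q t"
    if "base p \<noteq> base q" "base q \<noteq> base t" "base p \<noteq> base t" for p q t
    using f_c(1)[OF that, of 1] by (simp add: c_def)
  define u where "u = B.unit_inv (c ?a1 ?a2)"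
  define v where "v = B.unit_inv (c ?a1 ?a3)"
  have c12: "c ?a1 ?a2 \<in> gr' (\<phi>e (- deg ?a1 ?a2))" "c ?a1 ?a2 \<noteq> 0"
    and c13: "c ?a1 ?a3 \<in> gr' (\<phi>e (- deg ?a1 ?a3))" "c ?a1 ?a3 \<noteq> 0"
    and c21: "c ?a2 ?b1 \<in> gr' (\<phi>e (- deg ?a2 ?b1))" "c ?a2 ?b1 \<noteq> 0"
    using f_one[of ?a1 ?a2] f_one[of ?a1 ?a3] f_one[of ?a2 ?b1] i by (simp_all add: c_def)
  have u: "c ?a1 ?a2 * u = 1" "u * c ?a1 ?a2 = 1"
    and v: "c ?a1 ?a3 * v = 1" "v * c ?a1 ?a3 = 1"
    unfolding u_def v_def
    using B.unit_inv_right[OF c12] B.unit_inv_left[OF c12] B.unit_inv_right[OF c13]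
      B.unit_inv_left[OF c13] by auto
  have cancel_u: "u * (c ?a1 ?a2 * x) = x" "c ?a1 ?a2 * (u * x) = x" for x
    by (simp_all add: mult.assoc[symmetric] u)
  have cancel_v: "v * (c ?a1 ?a3 * x) = x" "c ?a1 ?a3 * (v * x) = x" for x
    by (simp_all add: mult.assoc[symmetric] v)
  define \<eta> where "\<eta> x = f ?a1 ?a2 x * u" for x
  have f12: "f ?a1 ?a2 x = \<eta> x * c ?a1 ?a2" for x
    by (simp add: \<eta>_def mult.assoc u)
  have f13: "f ?a1 ?a3 x = \<eta> x * c ?a1 ?a3" for x
    using f_c(1)[of ?a1 ?a2 ?a3 x] c_c[of ?a1 ?a2 ?a3] i by (simp add: f12 mult.assoc)
  \<comment> \<open>The detour through \<open>?a3\<close> is needed because \<open>?a2\<close> and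
    \<open>?b2\<close> have the same base, where \<open>f_c\<close> does not apply.\<close>
  have f12': "f ?a1 ?b2 x = \<eta> x * c ?a1 ?b2" for x
    using f_c(1)[of ?a1 ?a3 ?b2 x] c_c[of ?a1 ?a3 ?b2] i by (simp add: f13 mult.assoc)
  have f23: "f ?a2 ?a3 x = u * (\<eta> x * c ?a1 ?a3)" for x
    using f_c(2)[of ?a1 ?a2 ?a3 x] i f13[of x] cancel_u(1)[of "f ?a2 ?a3 x"] by simp
  have \<eta>_one: "\<eta> 1 = 1" by (simp add: \<eta>_def c_def[symmetric] u)
  have \<eta>_mult: "\<eta> (x * y) = \<eta> x * \<eta> y" for x y
  proof -
    have "\<eta> (x * y) * c ?a1 ?a3 = f ?a1 ?a2 x * f ?a2 ?a3 y"
      using f_mult[of ?a1 ?a2 ?a3 x y] i by (simp add: f13)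
    also have "\<dots> = \<eta> x * \<eta> y * c ?a1 ?a3"
      by (simp add: f12 f23 mult.assoc cancel_u)
    finally have "\<eta> (x * y) * c ?a1 ?a3 * v = \<eta> x * \<eta> y * c ?a1 ?a3 * v" by simp
    then show ?thesis by (simp add: mult.assoc v)
  qed
  \<comment> \<open>A product along a path from \<open>?a1\<close> to \<open>?b1\<close>. It
    replaces a value of \<open>c\<close> at the long root \<open>2 wt ?a1\<close>, which
    \<open>f_mult\<close> does not reach; by \<open>h_alt\<close> the path through
    \<open>?a3\<close> gives the same element.\<close>
  define h where "h = c ?a1 ?a2 * c ?a2 ?b1"
  have h_alt: "h = c ?a1 ?a3 * c ?a3 ?b1"
    using c_c[of ?a1 ?a2 ?a3] c_c[of ?a2 ?a3 ?b1] i by (simp add: h_def mult.assoc)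
  have h: "h \<in> gr' (\<phi>e (- deg ?a1 ?a2) + \<phi>e (- deg ?a2 ?b1))" "h \<noteq> 0"
    unfolding h_def using B.mult_gr[OF c12(1) c21(1)] B.mult_nonzero(1)[OF c12 c21(2)] by auto
  have f21': "f ?a2 ?b1 x = u * (\<eta> x * h)" for x
    using f_c(1)[of ?a2 ?a3 ?b1 x] i by (simp add: f23 h_alt mult.assoc)
  have c31': "c ?a3 ?b1 = v * h"
    by (simp add: h_alt cancel_v)
  let ?k12 = "twist ?a2 + twist ?b1" and ?k13 = "twist ?a3 + twist ?b1"
    and ?k23 = "twist ?a2 + twist ?b3"
  have star12: "f ?a1 ?b2 (\<iota> x) = msign ?k12 (\<iota>' (f ?a2 ?b1 x))" for x
    using f_star[of ?a2 ?b1 x] i by simp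
  have star13: "c ?a1 ?b3 = msign ?k13 (\<iota>' (c ?a3 ?b1))"
    using f_star[of ?a3 ?b1 1] i by (simp add: c_def)
  have star23: "c ?a3 ?b2 = msign ?k23 (\<iota>' (c ?a2 ?b3))"
    using f_star[of ?a2 ?b3 1] i by (simp add: c_def)
  have c12': "c ?a1 ?b2 = msign ?k12 (\<iota>' h * \<iota>' u)"
    using star12[of 1] f21'[of 1] by (simp add: c_def[symmetric] \<eta>_one B.inv_mult)
  have \<iota>u: "\<iota>' u * \<iota>' (c ?a1 ?a2) = 1"
    by (simp add: B.inv_mult[symmetric] u)
  have cancel_\<iota>u: "x = y" if "x * \<iota>' u = y * \<iota>' u" for x y
  proof -
    have "x * (\<iota>' u * \<iota>' (c ?a1 ?a2)) = y * (\<iota>' u * \<iota>' (c ?a1 ?a2))"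
      using that by (simp add: mult.assoc[symmetric])
    then show ?thesis by (simp add: \<iota>u)
  qed
  have msign_inj: "x = y" if "msign n x = msign n y" for n and x y :: 'b
    using that by (simp add: msign_def split: if_splits)
  \<comment> \<open>Evaluates \<open>f ?a1 ?b2 (\<iota> x)\<close> once by \<open>f12'\<close> and
    once by \<open>star12\<close>.\<close>
  have \<eta>_inv: "\<eta> (\<iota> x) * \<iota>' h = \<iota>' h * \<iota>' (\<eta> x)" for x
  proof -
    have "msign ?k12 (\<eta> (\<iota> x) * \<iota>' h * \<iota>' u) = f ?a1 ?b2 (\<iota> x)"
      by (simp add: f12' c12' msign_mult_right mult.assoc)
    also have "\<dots> = msign ?k12 (\<iota>' h * \<iota>' (\<eta> x) * \<iota>' u)"
      by (simp add: star12 f21' B.inv_mult mult.assoc)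
    finally show ?thesis by (rule cancel_\<iota>u[OF msign_inj])
  qed
  have \<iota>h: "\<iota>' h = h"
  proof -
    have "c ?a2 ?b3 = u * msign ?k13 (\<iota>' h * \<iota>' v)"
      using c_c[of ?a1 ?a2 ?b3] i cancel_u(1)[of "c ?a2 ?b3"] star13 c31' by (simp add: B.inv_mult)
    then have "c ?a3 ?b2 = msign ?k23 (\<iota>' (u * msign ?k13 (\<iota>' h * \<iota>' v)))"
      unfolding star23 by (rule arg_cong)
    also have "\<dots> = msign (?k23 + ?k13) (v * h * \<iota>' u)"
      by (simp only: B.inv_mult B.inv_msign B.inv_inv msign_mult_left msign_msign)
    \<comment> \<open>The exponents differ by \<open>twist ?a3 + twist ?b3\<close>, which is even by
      \<open>twist_star\<close>.\<close>
    also have "\<dots> = msign ?k12 (v * h * \<iota>' u)"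
      by (rule msign_cong) (use twist_star[of ?a3] in \<open>simp add: algebra_simps\<close>)
    finally have "msign ?k12 (\<iota>' h * \<iota>' u) = msign ?k12 (c ?a1 ?a3 * (v * h * \<iota>' u))"
      using c_c[of ?a1 ?a3 ?b2] i by (simp add: c12' msign_mult_right)
    then have "msign ?k12 (\<iota>' h * \<iota>' u) = msign ?k12 (h * \<iota>' u)"
      by (simp add: mult.assoc cancel_v)
    then show ?thesis by (rule cancel_\<iota>u[OF msign_inj])
  qed
  have \<eta>_inv': "\<eta> (\<iota> x) = h * \<iota>' (\<eta> x) * B.unit_inv h" for x
  proof -
    have "\<eta> (\<iota> x) * h * B.unit_inv h = h * \<iota>' (\<eta> x) * B.unit_inv h"
      using \<eta>_inv[of x] by (simp add: \<iota>h)
    then show ?thesis by (simp add: mult.assoc B.unit_inv_right[OF h])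
  qed
  have base12: "base ?a1 \<noteq> base ?a2" using i by simp
  have \<phi>e_0: "\<phi>e (\<alpha> - deg ?a1 ?a2) = \<phi>e \<alpha> + \<phi>e (- deg ?a1 ?a2)" for \<alpha>
    using \<phi>e_add[of \<alpha> "- deg ?a1 ?a2"] by simp
  \<comment> \<open>The map \<open>f ?a1 ?a2\<close> shifts degrees by the degree of
    \<open>c ?a1 ?a2\<close>, and the factor \<open>u\<close> cancels this shift.\<close>
  have \<eta>_gr: "\<eta> ` gr \<alpha> = gr' (\<phi>e \<alpha>)" for \<alpha>
  proof
    show "\<eta> ` gr \<alpha> \<subseteq> gr' (\<phi>e \<alpha>)"
    proof
      fix y assume "y \<in> \<eta> ` gr \<alpha>"
      then obtain x where x: "x \<in> gr \<alpha>" "y = f ?a1 ?a2 x * u" by (auto simp: \<eta>_def)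
      have "f ?a1 ?a2 x \<in> gr' (\<phi>e \<alpha> + \<phi>e (- deg ?a1 ?a2))"
        using f_gr[OF base12, of \<alpha>] x(1) \<phi>e_0 by auto
      moreover have "u \<in> gr' (- \<phi>e (- deg ?a1 ?a2))"
        unfolding u_def by (rule B.unit_inv_gr[OF c12])
      ultimately show "y \<in> gr' (\<phi>e \<alpha>)"
        using B.mult_gr x(2) by fastforce
    qed
    show "gr' (\<phi>e \<alpha>) \<subseteq> \<eta> ` gr \<alpha>"
    proof
      fix y assume "y \<in> gr' (\<phi>e \<alpha>)"
      then have "y * c ?a1 ?a2 \<in> gr' (\<phi>e (\<alpha> - deg ?a1 ?a2))"
        using B.mult_gr[OF _ c12(1)] \<phi>e_0 by simp
      then obtain x where "x \<in> gr \<alpha>" "y * c ?a1 ?a2 = f ?a1 ?a2 x"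
        using f_gr[OF base12, of \<alpha>] by blast
      moreover from this have "y = \<eta> x" unfolding \<eta>_def by (metis mult.assoc u(1) mult_1_right)
      ultimately show "y \<in> \<eta> ` gr \<alpha>" by blast
    qed
  qed
  have \<eta>_add: "\<eta> (x + y) = \<eta> x + \<eta> y" for x y
    by (simp add: \<eta>_def f_add[OF base12] algebra_simps)
  have \<eta>_smul: "\<eta> (smul k x) = smul' k (\<eta> x)" for k x
    by (simp add: \<eta>_def f_smul[OF base12] B.smul_mult_left)
  have \<eta>_linear: "Vector_Spaces.linear smul smul' \<eta>"
    using \<eta>_add \<eta>_smul A.vector_space_axioms B.vector_space_axioms
    by (simp add: Vector_Spaces.linear_iff)
  have "inj \<eta>"
    by (rule injI) (metis f12 f_inject[OF base12])
  moreover have "surj \<eta>"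
  proof -
    have surj_\<phi>e: "surj \<phi>e" using \<phi>e by (simp add: group_iso_on_def bij_betw_def)
    have "y \<in> range \<eta>" for y
    proof (induction y rule: B.homogeneous_induct)
      case (1 \<alpha> x)
      obtain \<beta> where "\<alpha> = \<phi>e \<beta>" using surj_\<phi>e by blast
      then show ?case using 1 \<eta>_gr[of \<beta>] by blast
    next
      case (2 x y)
      then obtain x' y' where "x = \<eta> x'" "y = \<eta> y'" by blast
      then have "x + y = \<eta> (x' + y')" by (simp add: \<eta>_add)
      then show ?case by blast
    qed
    then show ?thesis by blast
  qed
  ultimately have "bij \<eta>" by (simp add: bij_def)
  then show ?thesis using that \<eta>_linear \<eta>_mult \<eta>_one \<eta>_gr h \<iota>h \<eta>_inv' by blast
qed

end

context ssp_isotopy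
begin

text \<open>Composes the twisted isomorphism with the automorphism of the target torus from
  \<open>hermitian_twist\<close>, which turns the twisted involution into
  \<open>\<iota>'\<close>.\<close>

lemma isograded_isomorphic:
  assumes "CARD('r) \<ge> 3" "fg_free_abelian TYPE('k)"
  shows "isograded_isomorphic smul gr \<iota> smul' gr' \<iota>'"
proof -
  obtain \<tau> where "\<And>p. \<tau> (star p) = star (\<tau> p)"
    "\<And>p q. base p \<noteq> base q \<Longrightarrow> base (\<tau> p) \<noteq> base (\<tau> q)"
    "\<And>p q. \<phi>r (wt p - wt q) = wt (\<tau> p) - wt (\<tau> q)"
    using root_lattice_automorphism[OF \<phi>r nonzero_root_\<phi>r] by blast
  then interpret ssp_isotopy_weights smul gr \<iota> smul' gr' \<iota>' \<phi> \<phi>r \<phi>e s \<tau>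
    by unfold_locales
  obtain \<eta> h \<omega> where \<eta>: "bij \<eta>" "Vector_Spaces.linear smul smul' \<eta>"
    "\<And>x y. \<eta> (x * y) = \<eta> x * \<eta> y" "\<eta> 1 = 1" "\<And>\<alpha>. \<eta> ` gr \<alpha> = gr' (\<phi>e \<alpha>)"
    and h: "h \<in> gr' \<omega>" "h \<noteq> 0" "\<iota>' h = h"
    and \<eta>_inv: "\<And>x. \<eta> (\<iota> x) = h * \<iota>' (\<eta> x) * B.unit_inv h"
    using twisted_isomorphism[OF assms(1)] by blast
  obtain \<psi> T where \<psi>: "bij \<psi>" "Vector_Spaces.linear smul' smul' \<psi>"
    "\<And>x y. \<psi> (x * y) = \<psi> x * \<psi> y" "\<psi> 1 = 1"
    "\<And>x. \<psi> (h * \<iota>' x * B.unit_inv h) = \<iota>' (\<psi> x)"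
    and T: "group_iso_on UNIV UNIV T" "\<And>\<alpha>. \<psi> ` gr' \<alpha> = gr' (T \<alpha>)"
    using B.hermitian_twist[OF assms(2) h] by blast
  show ?thesis
    unfolding isograded_isomorphic_def
  proof (intro exI conjI allI)
    show "bij (\<psi> \<circ> \<eta>)" by (rule bij_comp[OF \<eta>(1) \<psi>(1)])
    show "Vector_Spaces.linear smul smul' (\<psi> \<circ> \<eta>)"
      using \<eta>(2) \<psi>(2) by (simp add: Vector_Spaces.linear_iff)
    show "group_iso_on UNIV UNIV (T \<circ> \<phi>e)"
      using T(1) \<phi>e by (auto simp: group_iso_on_def group_hom_on_def intro: bij_comp)
    show "(\<psi> \<circ> \<eta>) ` gr \<alpha> = gr' ((T \<circ> \<phi>e) \<alpha>)" for \<alpha>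
      unfolding image_comp[symmetric] by (simp add: \<eta>(5) T(2))
    show "(\<psi> \<circ> \<eta>) (\<iota> x) = \<iota>' ((\<psi> \<circ> \<eta>) x)" for x
      unfolding o_apply \<eta>_inv by (rule \<psi>(5))
  qed (simp_all add: \<eta>(3,4) \<psi>(3,4))
qed

end

theorem theorem11p10:
  fixes smul :: "'f::field_char_0 \<Rightarrow> 'a::ring_1 \<Rightarrow> 'a"
    and gr :: "'l::ab_group_add \<Rightarrow> 'a set"
    and \<iota> :: "'a \<Rightarrow> 'a"
    and smul' :: "'f \<Rightarrow> 'b::ring_1 \<Rightarrow> 'b"
    and gr' :: "'k::ab_group_add \<Rightarrow> 'b set"
    and \<iota>' :: "'b \<Rightarrow> 'b"
  assumes "CARD('r::finite) \<ge> 4"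
    and "fg_free_abelian TYPE('l)"
    and "fg_free_abelian TYPE('k)"
    and "assoc_torus_inv smul gr \<iota>"
    and "assoc_torus_inv smul' gr' \<iota>'"
  shows "(isograded_isomorphic smul gr \<iota> smul' gr' \<iota>' \<longleftrightarrow>
            bi_isomorphic (ssp TYPE('r) smul gr \<iota>) (ssp TYPE('r) smul' gr' \<iota>')) \<and>
         (bi_isomorphic (ssp TYPE('r) smul gr \<iota>) (ssp TYPE('r) smul' gr' \<iota>') \<longleftrightarrow>
            isotopic (ssp TYPE('r) smul gr \<iota>) (ssp TYPE('r) smul' gr' \<iota>'))"
    (is "(?a \<longleftrightarrow> ?b) \<and> (?b \<longleftrightarrow> ?c)")
proof -
  interpret two_tori smul gr \<iota> smul' gr' \<iota>'
    unfolding two_tori_def char_0_torus_inv_def using assms(4,5) by blast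
  have "?a \<Longrightarrow> ?b"
  proof -
    assume ?a
    then obtain \<eta> \<eta>gr where "isograded_iso smul gr \<iota> smul' gr' \<iota>' \<eta> \<eta>gr"
      unfolding isograded_isomorphic_def isograded_iso_def isograded_iso_axioms_def
      using two_tori_axioms by blast
    then show ?b by (rule isograded_iso.ssp_bi_isomorphic)
  qed
  moreover have "?b \<Longrightarrow> ?c"
  proof -
    assume b: ?b
    let ?L = "ssp TYPE('r) smul gr \<iota>" and ?s = "\<lambda>_ :: int^'r. 0 :: 'l"
    \<comment> \<open>The zero homomorphism exhibits the algebra as an isotope of itself.\<close>
    have "isotope ?L ?s = ?L" by (simp add: isotope_def ssp_def)
    moreover have "admissible ?L ?s"
      using A.root_space_nonzero by (auto simp: admissible_def ssp_def nonzero_root_iff)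
    moreover have "group_hom_on root_lattice ?s" by (simp add: group_hom_on_def)
    ultimately show ?c unfolding isotopic_def using b by metis
  qed
  moreover have "?c \<Longrightarrow> ?a"
  proof -
    assume ?c
    then obtain s \<phi> \<phi>r \<phi>e where s: "admissible (ssp TYPE('r) smul gr \<iota>) s"
      and iso: "lie_iso (isotope (ssp TYPE('r) smul gr \<iota>) s) (ssp TYPE('r) smul' gr' \<iota>') \<phi>"
      and \<phi>r: "group_iso_on root_lattice root_lattice \<phi>r" and \<phi>e: "group_iso_on UNIV UNIV \<phi>e"
      and comp: "\<forall>\<beta>\<in>root_lattice. \<forall>\<alpha>. \<phi> ` lie_comp (isotope (ssp TYPE('r) smul gr \<iota>) s) \<beta> \<alpha>
        = lie_comp (ssp TYPE('r) smul' gr' \<iota>') (\<phi>r \<beta>) (\<phi>e \<alpha>)"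
      unfolding isotopic_def bi_isomorphic_def by blast
    have "ssp_isotopy smul gr \<iota> smul' gr' \<iota>' \<phi> \<phi>r \<phi>e s"
    proof (unfold_locales, goal_cases)
      case 1
      show ?case using iso by (simp add: lie_iso_def isotope_def ssp_def)
    next
      case (4 \<beta>)
      then show ?case using s by (auto simp: admissible_def ssp_def nonzero_root_iff)
    next
      case (5 \<beta> \<alpha>)
      then show ?case using comp by (simp add: isotope_def ssp_def)
    qed (fact \<phi>r \<phi>e)+
    then show ?a
      by (rule ssp_isotopy.isograded_isomorphic) (use assms in simp_all)
  qed
  ultimately show ?thesis by blast
qed

end
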